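(* Let $N\ge 3$ be an integer, let $\mathbb F$ be an infinite field of characteristic $p>0$ with $p\nmid N$, and let $R=\mathbb F[[X,Y,Z]]/(X^N+Y^N+Z^N)$. Let $x,y,z$ be the images of $X,Y,Z$ in $R$, and put $I=(y,z)$ and $\mathfrak m=(x,y,z)$. Then: (i) $(I^k)^*=\mathfrak m^{k+1}+I^k$ for all $k\ge 1$; and (ii) $r^*(I)=N-2$.
   Context: $J^*$ denotes the tight closure of an ideal $J$ of $R$: $u\in J^*$ iff there is $c\in R$, not in any minimal prime of $R$, with $cu^q\in J^{[q]}$ for all sufficiently large $q=p^e$, where $J^{[q]}$ is generated by the $q$-th powers of elements of $J$. $r^*(I)$ is the tight reduction number of $I$, i.e. the reduction number of the filtration $\{(I^n)^*\}_{n}$ with respect to $I$: the smallest integer $n\ge0$ such that $I(I^{m})^*=(I^{m+1})^*$ for all $m\ge n$ (where $(I^0)^*=R$). *)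

theory Defs
  imports
    "HOL-Algebra.Algebra"
    "HOL-Algebra.Algebraic_Closure_Type"
    "HOL-Computational_Algebra.Formal_Power_Series"
    "HOL-Library.Extended_Nat"
begin

section \<open>Tight closure and reduction numbers\<close>

text \<open>Powers of ideals are powers in the semiring of ideals; in particular the zeroth power
  is the whole ring.\<close>

abbreviation ideal_power :: "('a, 'b) ring_scheme \<Rightarrow> 'a set \<Rightarrow> nat \<Rightarrow> 'a set" where
  "ideal_power R I n \<equiv> I [^]\<^bsub>ideals_set R\<^esub> n"

definition minimal_primes :: "('a, 'b) ring_scheme \<Rightarrow> 'a set set" where
  "minimal_primes R = {P. primeideal P R \<and> (\<forall>Q. primeideal Q R \<longrightarrow> Q \<subseteq> P \<longrightarrow> Q = P)}"

definition frobenius_power :: "('a, 'b) ring_scheme \<Rightarrow> 'a set \<Rightarrow> nat \<Rightarrow> 'a set" where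
  "frobenius_power R J q = Idl\<^bsub>R\<^esub> ((\<lambda>a. a [^]\<^bsub>R\<^esub> q) ` J)"

text \<open>The argument \<open>p\<close> is the characteristic of \<open>R\<close>.\<close>

definition tight_closure :: "nat \<Rightarrow> ('a, 'b) ring_scheme \<Rightarrow> 'a set \<Rightarrow> 'a set" where
  "tight_closure p R J =
     {u \<in> carrier R. \<exists>c \<in> carrier R - \<Union>(minimal_primes R).
        \<exists>e0. \<forall>e\<ge>e0. c \<otimes>\<^bsub>R\<^esub> u [^]\<^bsub>R\<^esub> (p ^ e) \<in> frobenius_power R J (p ^ e)}"

text \<open>The reduction number is \<open>\<infinity>\<close> if no \<open>n\<close> has the required property, since \<open>Inf {} = \<infinity>\<close>
  in \<^typ>\<open>enat\<close>.\<close>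

definition reduction_number ::
    "('a, 'b) ring_scheme \<Rightarrow> (nat \<Rightarrow> 'a set) \<Rightarrow> 'a set \<Rightarrow> enat" where
  "reduction_number R F I =
     Inf {enat n | n. \<forall>m\<ge>n. I \<cdot>\<^bsub>R\<^esub> F m = F (m + 1)}"

text \<open>No separate convention is needed for the zeroth term of the filtration: the zeroth
  power of \<open>I\<close> is \<open>R\<close>, and \<open>R\<close> is its own tight closure (take \<open>c = 1\<close>).\<close>

definition tight_reduction_number :: "nat \<Rightarrow> ('a, 'b) ring_scheme \<Rightarrow> 'a set \<Rightarrow> enat" where
  "tight_reduction_number p R I =
     reduction_number R (\<lambda>n. tight_closure p R (ideal_power R I n)) I"


section \<open>The Fermat hypersurface ring\<close>

text \<open>The ring of power series in \<open>X\<close>, \<open>Y\<close>, \<open>Z\<close> is represented as the iterated power series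
  ring in which \<open>X\<close> is the innermost and \<open>Z\<close> the outermost variable.\<close>

type_synonym 'a fps3 = "'a fps fps fps"

definition X3 :: "'a::field fps3" where "X3 = fps_const (fps_const fps_X)"
definition Y3 :: "'a::field fps3" where "Y3 = fps_const fps_X"
definition Z3 :: "'a::field fps3" where "Z3 = fps_X"

definition fermat_ideal :: "nat \<Rightarrow> 'a::field fps3 set" where
  "fermat_ideal N = Idl\<^bsub>ring_of_type_algebra\<^esub> {X3 ^ N + Y3 ^ N + Z3 ^ N}"

definition fermat_ring :: "nat \<Rightarrow> 'a::field fps3 set ring" where
  "fermat_ring N = ring_of_type_algebra Quot (fermat_ideal N)"

definition fermat_residue :: "nat \<Rightarrow> 'a::field fps3 \<Rightarrow> 'a fps3 set" where
  "fermat_residue N f = fermat_ideal N +>\<^bsub>ring_of_type_algebra\<^esub> f"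

end

theory Submission
  imports Defs
begin

text \<open>Let \<open>K\<close> be the algebraic closure of the base field. The Fermat curve has a totally
  ramified point over \<open>x = 0\<close>, so there is a series \<open>t\<close> in \<open>\<tau>^N\<close> with
  \<open>\<tau>^N + t^N + 1 = 0\<close>, and \<open>x \<mapsto> \<tau> T\<close>, \<open>y \<mapsto> t T\<close>, \<open>z \<mapsto> T\<close> embeds the Fermat ring into
  \<open>K[[\<tau>]][[T]]\<close>; injectivity is seen on exponents of \<open>\<tau>\<close> modulo \<open>N\<close>.

  Suppose \<open>c f^q\<close> lies in the Frobenius power of \<open>I^k\<close> for all large \<open>q\<close>. Comparing lowest
  terms in \<open>T\<close> gives \<open>C u^q = \<Sum>\<^sub>a s\<^sub>a t^(a q)\<close> in \<open>K[[\<tau>]]\<close>, where \<open>C\<close> and the \<open>s\<^sub>a\<close> stay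
  in a finite-dimensional space \<open>V\<close> independent of \<open>q\<close>. As soon as \<open>q\<close> exceeds all orders of
  nonzero elements of \<open>V\<close>, this can be compared coefficientwise in \<open>\<tau>^q\<close>; since \<open>t\<close> is a
  series in \<open>\<tau>^N\<close>, so is \<open>u\<close>, and the leading form of \<open>f\<close> involves no \<open>x\<close>. Conversely,
  \<open>y^N\<close> multiplies the \<open>q\<close>-th powers of \<open>\<mm>^(k+1)\<close> into the Frobenius power, because
  reducing \<open>x^(i q)\<close> by \<open>x^N = - y^N - z^N\<close> loses less than \<open>N\<close> in degree. The reduction
  number is determined by \<open>x^(N-1) \<notin> I\<close> and \<open>x^N \<in> I \<mm>^(N-1)\<close>.\<close>

section \<open>Power series in prime characteristic\<close>

lemma add_power_CHAR:
  fixes a b :: "'a::idom"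
  assumes "CHAR('a) > 0"
  shows "(a + b) ^ (CHAR('a) ^ e) = a ^ (CHAR('a) ^ e) + b ^ (CHAR('a) ^ e)"
proof (induction e)
  case (Suc e)
  let ?p = "CHAR('a)"
  have frob: "(u + v) ^ ?p = u ^ ?p + v ^ ?p" for u v :: 'a
  proof -
    have "of_nat (?p choose k) * u ^ k * v ^ (?p - k) = 0" if "k \<in> {..?p} - {0, ?p}" for k
    proof -
      have "?p dvd (?p choose k)"
        using that assms prime_CHAR_semidom[where ?'a = 'a] by (intro dvd_choose_prime) auto
      then show ?thesis by (simp add: of_nat_eq_0_iff_char_dvd)
    qed
    then have "(\<Sum>k\<le>?p. of_nat (?p choose k) * u ^ k * v ^ (?p - k))
        = (\<Sum>k\<in>{0, ?p}. of_nat (?p choose k) * u ^ k * v ^ (?p - k))"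
      by (intro sum.mono_neutral_right) auto
    also have "\<dots> = u ^ ?p + v ^ ?p" using assms by simp
    finally show ?thesis by (simp add: binomial_ring)
  qed
  show ?case by (simp add: power_mult frob Suc mult.commute[of ?p] flip: power_mult)
    (simp add: power_mult frob Suc)
qed simp

text \<open>Frobenius additivity covers finite sums only. The constant term is therefore split off,
  and the induction on the index passes to the shifted series.\<close>

lemma fps_nth_power_CHAR:
  fixes f :: "'a::idom fps"
  assumes "CHAR('a) > 0" and q: "q = CHAR('a) ^ e"
  shows "(f ^ q) $ n = (if q dvd n then (f $ (n div q)) ^ q else 0)"
proof (induction n arbitrary: f rule: less_induct)
  case (less n)
  have q0: "q > 0" using assms by simp
  have "f = fps_const (f $ 0) + fps_X * fps_shift 1 f"
    by (rule fps_ext) (simp add: fps_X_mult_nth)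
  then have "f ^ q = fps_const (f $ 0) ^ q + (fps_X * fps_shift 1 f) ^ q"
    using assms(1) q add_power_CHAR[where 'a = "'a fps"] by (metis semiring_char_fps)
  then have *: "f ^ q = fps_const ((f $ 0) ^ q) + fps_X ^ q * (fps_shift 1 f) ^ q"
    by (simp add: fps_const_power power_mult_distrib)
  show ?case
  proof (cases "n < q")
    case True
    then show ?thesis using q0 unfolding *
      by (cases "n = 0") (auto simp: fps_X_power_mult_nth dvd_imp_le)
  next
    case False
    then obtain m where m: "n = q + m" using le_Suc_ex by (metis not_less)
    have "(f ^ q) $ n = (fps_shift 1 f ^ q) $ m"
      using q0 m unfolding * by (simp add: fps_X_power_mult_nth)
    also have "\<dots> = (if q dvd m then (fps_shift 1 f $ (m div q)) ^ q else 0)"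
      using q0 m by (intro less) simp
    finally show ?thesis using q0 m by simp
  qed
qed

lemma fps_nth_mult_power_CHAR:
  fixes f g :: "'a::idom fps"
  assumes "CHAR('a) > 0" and q: "q = CHAR('a) ^ e"
  shows "(f * g ^ q) $ n = (\<Sum>i\<le>n div q. f $ (n - i * q) * (g $ i) ^ q)"
proof -
  have q0: "q > 0" using assms by simp
  have "(f * g ^ q) $ n = (\<Sum>j=0..n. (g ^ q) $ j * f $ (n - j))"
    by (subst mult.commute) (simp add: fps_mult_nth)
  also have "\<dots> = (\<Sum>j\<in>(\<lambda>i. i * q) ` {..n div q}. (g ^ q) $ j * f $ (n - j))"
  proof (rule sum.mono_neutral_right)
    show "(\<lambda>i. i * q) ` {..n div q} \<subseteq> {0..n}"
      using q0 by (auto simp: less_eq_div_iff_mult_less_eq)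
    show "\<forall>j\<in>{0..n} - (\<lambda>i. i * q) ` {..n div q}. (g ^ q) $ j * f $ (n - j) = 0"
    proof
      fix j assume j: "j \<in> {0..n} - (\<lambda>i. i * q) ` {..n div q}"
      have "\<not> q dvd j"
      proof
        assume "q dvd j"
        then have "j = (j div q) * q" by simp
        moreover have "j div q \<le> n div q" using j by (intro div_le_mono) simp
        ultimately show False using j by blast
      qed
      then show "(g ^ q) $ j * f $ (n - j) = 0"
        using fps_nth_power_CHAR[OF assms] by simp
    qed
  qed simp
  also have "\<dots> = (\<Sum>i\<le>n div q. (g ^ q) $ (i * q) * f $ (n - i * q))"
    using q0 by (subst sum.reindex) (auto simp: inj_on_def)
  finally show ?thesis
    using q0 by (simp add: fps_nth_power_CHAR[OF assms] mult.commute)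
qed

interpretation fps_vs: Vector_Spaces.vector_space "\<lambda>(c::'a::field) f. fps_const c * f"
  by unfold_locales (auto simp: algebra_simps fps_const_add[symmetric] fps_const_mult[symmetric]
      simp del: fps_const_add fps_const_mult)

text \<open>By induction on the generators. A new generator \<open>a\<close> outside the old span
  keeps a bounded \<open>X\<close>-adic distance from it: otherwise approximations from the span
  would become stationary by the old bound, and \<open>a\<close> would be one of them.\<close>

lemma finite_span_subdegree_bound:
  fixes S :: "'a::field fps set"
  assumes "finite S"
  shows "\<exists>B. \<forall>v\<in>fps_vs.span S. (\<forall>n<B. v $ n = 0) \<longrightarrow> v = 0"
  using assms
proof (induction S rule: finite_induct)
  case empty
  then show ?case by simp
next
  case (insert a S)
  then obtain B where B: "\<And>v. v \<in> fps_vs.span S \<Longrightarrow> \<forall>n<B. v $ n = 0 \<Longrightarrow> v = 0" by blast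
  show ?case
  proof (cases "a \<in> fps_vs.span S")
    case True
    then have "fps_vs.span (insert a S) = fps_vs.span S" by (simp add: fps_vs.span_redundant)
    then show ?thesis using B by blast
  next
    case False
    have "\<exists>B'. \<forall>w\<in>fps_vs.span S. \<exists>n<B'. w $ n \<noteq> a $ n"
    proof (rule ccontr)
      assume "\<not> ?thesis"
      then have "\<forall>B'. \<exists>w\<in>fps_vs.span S. \<forall>n<B'. w $ n = a $ n" by blast
      then obtain w where w: "\<And>m. w m \<in> fps_vs.span S" "\<And>m n. n < m \<Longrightarrow> w m $ n = a $ n"
        by metis
      have "a $ n = w B $ n" for n
      proof -
        have "w (max B (Suc n)) - w B = 0"
          by (rule B) (auto intro!: fps_vs.span_diff w simp: w(2))
        then have "w B = w (max B (Suc n))" by simp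
        then show ?thesis by (simp add: w(2))
      qed
      then have "a = w B" by (intro fps_ext)
      then show False using False w(1) by simp
    qed
    then obtain B' where B': "\<And>w. w \<in> fps_vs.span S \<Longrightarrow> \<exists>n<B'. w $ n \<noteq> a $ n" by blast
    show ?thesis
    proof (intro exI[of _ "max B B'"] ballI impI)
      fix v assume v: "v \<in> fps_vs.span (insert a S)" and v0: "\<forall>n<max B B'. v $ n = 0"
      from v obtain c where c: "v - fps_const c * a \<in> fps_vs.span S"
        by (auto simp: fps_vs.span_insert)
      show "v = 0"
      proof (cases "c = 0")
        case True
        then show ?thesis using c v0 B by simp
      next
        case False
        \<comment> \<open>This element is \<open>a - v / c\<close>, so it agrees with
          \<open>a\<close> wherever \<open>v\<close> vanishes.\<close>
        have "fps_const (- inverse c) * (v - fps_const c * a) \<in> fps_vs.span S"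
          by (intro fps_vs.span_scale c)
        from B'[OF this] obtain n where "n < B'"
          and n: "(fps_const (- inverse c) * (v - fps_const c * a)) $ n \<noteq> a $ n" by blast
        then show ?thesis using v0 False by simp
      qed
    qed
  qed
qed

text \<open>For large \<open>q\<close>, elements of a finite-dimensional space are linearly independent over the
  \<open>q\<close>-th powers, so the identity between them may be compared coefficientwise in \<open>X^q\<close>.\<close>

lemma coefficients_vanish_if_power_combination:
  fixes c u :: "'a::field fps" and b s :: "'i \<Rightarrow> 'a fps"
  assumes CHAR: "CHAR('a) > 0" and q: "q = CHAR('a) ^ e" and "B \<le> q"
    and V: "fps_vs.subspace V" and B: "\<And>v. v \<in> V \<Longrightarrow> \<forall>n<B. v $ n = 0 \<Longrightarrow> v = 0"
    and "c \<in> V" "c \<noteq> 0" and s: "\<And>i. i \<in> A \<Longrightarrow> s i \<in> V"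
    and eq: "c * u ^ q = (\<Sum>i\<in>A. s i * b i ^ q)"
    and m: "\<And>i. i \<in> A \<Longrightarrow> b i $ m = 0"
  shows "u $ m = 0"
proof -
  have q0: "q > 0" using CHAR q by simp
  \<comment> \<open>Expanding \<open>u^q\<close> and \<open>b i ^ q\<close> by Frobenius,
    \<open>D j\<close> collects what multiplies \<open>X^(j q)\<close> in the difference of the two
    sides. The \<open>q\<close>-th powers enter as scalars, so \<open>D j\<close> stays in
    \<open>V\<close>.\<close>
  define D where "D j = fps_const ((u $ j) ^ q) * c - (\<Sum>i\<in>A. fps_const ((b i $ j) ^ q) * s i)" for j
  have D_in: "D j \<in> V" for j
    unfolding D_def using V \<open>c \<in> V\<close> s
    by (intro fps_vs.subspace_diff fps_vs.subspace_sum fps_vs.subspace_scale) auto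
  have D_sum: "(\<Sum>j\<le>n div q. D j $ (n - j * q)) = 0" for n
  proof -
    have "(\<Sum>j\<le>n div q. D j $ (n - j * q))
        = (\<Sum>j\<le>n div q. c $ (n - j * q) * (u $ j) ^ q)
          - (\<Sum>i\<in>A. \<Sum>j\<le>n div q. s i $ (n - j * q) * (b i $ j) ^ q)"
      unfolding D_def by (subst sum.swap) (simp add: sum_subtractf fps_sum_nth mult.commute)
    also have "\<dots> = (c * u ^ q) $ n - (\<Sum>i\<in>A. s i * b i ^ q) $ n"
      by (simp add: fps_sum_nth fps_nth_mult_power_CHAR[OF CHAR q])
    finally show ?thesis by (simp add: eq)
  qed
  have "D j = 0" for j
  proof (induction j rule: less_induct)
    case (less j)
    show ?case
    proof (rule B[OF D_in], intro allI impI)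
      \<comment> \<open>The coefficient at \<open>j q + n\<close> involves only \<open>D i\<close>
        with \<open>i \<le> j\<close>, because \<open>n < q\<close>. The earlier ones vanish by
        induction, so \<open>D j\<close> vanishes up to order \<open>B\<close> and hence is
        zero.\<close>
      fix n assume "n < B"
      then have n: "n < q" using \<open>B \<le> q\<close> by simp
      then have "(j * q + n) div q = j" using q0 by simp
      then have "0 = (\<Sum>i\<le>j. D i $ (j * q + n - i * q))" using D_sum[of "j * q + n"] by simp
      also have "\<dots> = (\<Sum>i\<in>{j}. D i $ (j * q + n - i * q))"
        using less by (intro sum.mono_neutral_right) auto
      finally show "D j $ n = 0" by simp
    qed
  qed
  then have "D m = 0" .
  \<comment> \<open>At index \<open>m\<close> every \<open>b i\<close> drops out of
    \<open>D m\<close>.\<close>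
  then have "fps_const ((u $ m) ^ q) * c = 0"
    unfolding D_def using q0 m by (simp add: power_0_left)
  then show ?thesis using \<open>c \<noteq> 0\<close> by simp
qed

section \<open>A branch of the Fermat curve\<close>

text \<open>The series \<open>(1 + X)^N - 1\<close> has linear coefficient
  \<open>N \<noteq> 0\<close>, so it has a compositional inverse; adding 1 to that inverse gives the
  root.\<close>

lemma fps_nth_root_one_plus_X:
  assumes "of_nat N \<noteq> (0 :: 'a::field)"
  shows "\<exists>s :: 'a fps. s ^ N = 1 + fps_X"
proof -
  define a :: "'a fps" where "a = (1 + fps_X) ^ N - 1"
  have "((1 + fps_X :: 'a fps) ^ n) $ 0 = 1 \<and> ((1 + fps_X :: 'a fps) ^ n) $ Suc 0 = of_nat n" for n
    by (induction n) (auto simp: fps_mult_nth)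
  then have a: "a $ 0 = 0" "a $ 1 \<noteq> 0" using assms by (auto simp: a_def)
  have g0: "fps_inv a $ 0 = 0" by (simp add: fps_inv_def)
  have "(1 + fps_X) ^ N oo fps_inv a = (1 + fps_inv a) ^ N"
    using g0 by (simp add: fps_compose_power[symmetric] fps_compose_add_distrib)
  moreover have "(1 + fps_X) ^ N oo fps_inv a = 1 + fps_X"
    using fps_inv_right[OF a] by (simp add: a_def fps_compose_sub_distrib algebra_simps)
  ultimately show ?thesis by metis
qed

text \<open>A branch of the Fermat curve at a point with \<open>x = 0\<close>, parametrised by \<open>x\<close>: the
  ramification is total, so \<open>t\<close> is a series in \<open>X^N\<close>.\<close>

lemma fermat_branch_exists:
  assumes "of_nat N \<noteq> (0 :: 'a::alg_closed_field)" "N > 0"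
  shows "\<exists>t :: 'a fps. fps_X ^ N + t ^ N + 1 = 0 \<and> (\<forall>n. \<not> N dvd n \<longrightarrow> t $ n = 0)"
proof -
  obtain s :: "'a fps" where s: "s ^ N = 1 + fps_X"
    using fps_nth_root_one_plus_X[OF assms(1)] by blast
  obtain \<theta> :: 'a where \<theta>: "\<theta> ^ N = - 1" using nth_root_exists assms(2) by blast
  \<comment> \<open>The root of \<open>1 + X\<close> is taken at \<open>X^N\<close> and twisted by
    an \<open>N\<close>-th root of -1. The substitution confines \<open>t\<close> to exponents
    divisible by \<open>N\<close>.\<close>
  define t where "t = fps_const \<theta> * (s oo fps_X ^ N)"
  have X0: "(fps_X ^ N :: 'a fps) $ 0 = 0" using assms(2) by simp
  have "t ^ N = fps_const (\<theta> ^ N) * (s ^ N oo fps_X ^ N)"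
    unfolding t_def power_mult_distrib fps_compose_power[OF X0] by (simp add: fps_const_power)
  also have "\<dots> = - (1 + fps_X ^ N)"
    unfolding s \<theta> using X0 by (simp add: fps_compose_add_distrib fps_const_neg[symmetric] del: fps_const_neg)
  finally have "fps_X ^ N + t ^ N + 1 = 0" by simp
  moreover have "\<forall>n. \<not> N dvd n \<longrightarrow> t $ n = 0"
    by (auto simp: t_def fps_nth_compose_X_power)
  ultimately show ?thesis by blast
qed

lemma fps_mult_supported_on_multiples:
  assumes "\<And>n. \<not> N dvd n \<Longrightarrow> f $ n = 0" "\<And>n. \<not> N dvd n \<Longrightarrow> g $ n = 0" "\<not> N dvd n"
  shows "(f * g :: 'a::comm_ring_1 fps) $ n = 0"
  unfolding fps_mult_nth
proof (rule sum.neutral, rule ballI)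
  fix i assume "i \<in> {0..n}"
  then have "\<not> N dvd i \<or> \<not> N dvd n - i"
    using assms(3) by (metis atLeastAtMost_iff dvd_add le_add_diff_inverse)
  then show "f $ i * g $ (n - i) = 0" using assms by auto
qed

lemma fps_power_supported_on_multiples:
  assumes "\<And>n. \<not> N dvd n \<Longrightarrow> f $ n = 0" "\<not> N dvd n"
  shows "(f ^ j :: 'a::comm_ring_1 fps) $ n = 0"
  using assms(2)
proof (induction j arbitrary: n)
  case 0
  then show ?case by (cases "n = 0") auto
next
  case (Suc j)
  then show ?case using fps_mult_supported_on_multiples[of N f "f ^ j" n] assms(1) by auto
qed

lemma linear_power_combination_eq_0:
  fixes a :: "nat \<Rightarrow> 'a::idom"
  assumes "(\<Sum>j\<le>d. smult (a j) ([:\<theta>, 1:] ^ j)) = 0" "j \<le> d"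
  shows "a j = 0"
  using assms
proof (induction d)
  case (Suc d)
  have "coeff (\<Sum>j\<le>d. smult (a j) ([:\<theta>, 1:] ^ j)) (Suc d) = 0"
    by (auto simp: coeff_sum intro!: sum.neutral coeff_eq_0 simp: degree_linear_power)
  then have "coeff (\<Sum>j\<le>Suc d. smult (a j) ([:\<theta>, 1:] ^ j)) (Suc d) = a (Suc d)"
    using coeff_linear_power[of \<theta> "Suc d"] by (simp del: power_Suc)
  then have "a (Suc d) = 0" unfolding Suc.prems(1) by simp
  then show ?case using Suc by (cases "j = Suc d") auto
qed simp

text \<open>Without its constant term, \<open>t\<close> becomes a nonzero series \<open>w\<close>
  that may be substituted into others, and that substitution is injective. Only the zero polynomial
  can then vanish at \<open>t\<close>.\<close>

lemma nonconstant_fps_transcendental: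
  fixes t :: "'a::field fps"
  assumes t: "t \<noteq> fps_const (t $ 0)" and "(\<Sum>j\<le>d. fps_const (a j) * t ^ j) = 0" "j \<le> d"
  shows "a j = 0"
proof -
  define w where "w = t - fps_const (t $ 0)"
  have w: "w $ 0 = 0" "w \<noteq> 0" "t = w + fps_const (t $ 0)" using t by (auto simp: w_def)
  let ?P = "\<Sum>j\<le>d. smult (a j) ([:t $ 0, 1:] ^ j)"
  have "fps_of_poly ?P oo w = (\<Sum>j\<le>d. fps_const (a j) * (w + fps_const (t $ 0)) ^ j)"
    using w(1) by (simp add: fps_of_poly_sum fps_of_poly_smult fps_of_poly_power fps_of_poly_linear
        fps_compose_sum_distrib fps_compose_mult_distrib fps_compose_power[symmetric]
        fps_compose_add_distrib)
  then have "fps_of_poly ?P oo w = 0" using assms(2) w(3) by simp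
  then have "fps_of_poly ?P = fps_of_poly 0" using w by (simp add: fps_compose_eq_0_iff)
  then have "?P = 0" unfolding fps_of_poly_eq_iff .
  then show ?thesis using linear_power_combination_eq_0 assms(3) by blast
qed

section \<open>Ring homomorphisms given by graded evaluation of power series\<close>

locale comm_ring_morphism =
  fixes \<phi> :: "'a::comm_ring_1 \<Rightarrow> 'b::comm_ring_1"
  assumes hom_add: "\<phi> (x + y) = \<phi> x + \<phi> y"
    and hom_mult: "\<phi> (x * y) = \<phi> x * \<phi> y"
    and hom_1 [simp]: "\<phi> 1 = 1"
begin

lemma hom_0 [simp]: "\<phi> 0 = 0"
  using hom_add[of 0 0] by simp

lemma hom_minus: "\<phi> (- x) = - \<phi> x"
  using hom_add[of x "- x"] by (simp add: eq_neg_iff_add_eq_0 add.commute)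

lemma hom_diff: "\<phi> (x - y) = \<phi> x - \<phi> y"
  using hom_add[of x "- y"] by (simp add: hom_minus)

lemma hom_sum: "\<phi> (sum f A) = (\<Sum>i\<in>A. \<phi> (f i))"
  by (induction A rule: infinite_finite_induct) (auto simp: hom_add)

lemma hom_power: "\<phi> (x ^ n) = \<phi> x ^ n"
  by (induction n) (auto simp: hom_mult)

end

text \<open>Evaluation of a power series at \<open>\<beta> T\<close>, the coefficients being mapped by \<open>\<phi>\<close>
  to power series in \<open>T\<close>.\<close>

definition fps_graded_eval :: "('a::comm_ring_1 \<Rightarrow> 'b::comm_ring_1 fps) \<Rightarrow> 'b \<Rightarrow> 'a fps \<Rightarrow> 'b fps" where
  "fps_graded_eval \<phi> \<beta> a = Abs_fps (\<lambda>n. \<Sum>j\<le>n. \<phi> (a $ j) $ (n - j) * \<beta> ^ j)"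

lemma fps_graded_eval_const:
  assumes "\<phi> 0 = 0"
  shows "fps_graded_eval \<phi> \<beta> (fps_const c) = \<phi> c"
proof (rule fps_ext)
  fix n
  have "(\<Sum>j\<le>n. \<phi> (fps_const c $ j) $ (n - j) * \<beta> ^ j) = (\<Sum>j\<in>{0}. \<phi> (fps_const c $ j) $ (n - j) * \<beta> ^ j)"
    using assms by (intro sum.mono_neutral_right) auto
  then show "fps_graded_eval \<phi> \<beta> (fps_const c) $ n = \<phi> c $ n"
    by (simp add: fps_graded_eval_def)
qed

lemma fps_graded_eval_X:
  assumes "comm_ring_morphism \<phi>"
  shows "fps_graded_eval \<phi> \<beta> fps_X = fps_const \<beta> * fps_X"
proof (rule fps_ext)
  interpret comm_ring_morphism \<phi> by fact
  fix n
  have "(\<Sum>j\<le>n. \<phi> (fps_X $ j) $ (n - j) * \<beta> ^ j)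
      = (\<Sum>j\<in>(if n = 0 then {} else {1}). \<phi> (fps_X $ j) $ (n - j) * \<beta> ^ j)"
    by (intro sum.mono_neutral_right) (auto simp: fps_X_def)
  then show "fps_graded_eval \<phi> \<beta> fps_X $ n = (fps_const \<beta> * fps_X) $ n"
    by (auto simp: fps_graded_eval_def)
qed

lemma fps_graded_eval_mult:
  assumes "comm_ring_morphism \<phi>"
  shows "fps_graded_eval \<phi> \<beta> (a * b) = fps_graded_eval \<phi> \<beta> a * fps_graded_eval \<phi> \<beta> b"
proof (rule fps_ext)
  interpret comm_ring_morphism \<phi> by fact
  fix n
  let ?g = "\<lambda>i m l k. \<phi> (a $ i) $ m * \<phi> (b $ l) $ k * \<beta> ^ (i + l)"
  have "fps_graded_eval \<phi> \<beta> (a * b) $ n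
      = (\<Sum>j\<le>n. \<Sum>i\<le>j. \<Sum>m\<le>n - j. ?g i m (j - i) (n - j - m))"
    by (auto simp: fps_graded_eval_def fps_mult_nth hom_sum hom_mult fps_sum_nth sum_distrib_right
        atLeast0AtMost intro!: sum.cong)
  also have "\<dots> = (\<Sum>(j, i, m)\<in>Sigma {..n} (\<lambda>j. {..j} \<times> {..n - j}). ?g i m (j - i) (n - j - m))"
    by (simp add: sum.Sigma sum.cartesian_product split_def) (auto intro!: sum.cong)
  \<comment> \<open>Both sides run over quadruples \<open>(i, m, l, k)\<close> of sum
    \<open>n\<close>. They are grouped by \<open>i + l\<close>, the exponent of
    \<open>\<beta>\<close>, on the left, and by \<open>i + m\<close>, the degree contributed by
    \<open>a\<close>, on the right.\<close>
  also have "\<dots> = (\<Sum>(r, i, l)\<in>Sigma {..n} (\<lambda>r. {..r} \<times> {..n - r}). ?g i (r - i) l (n - r - l))"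
    by (rule sum.reindex_bij_witness[where i = "\<lambda>(r, i, l). (i + l, i, r - i)"
          and j = "\<lambda>(j, i, m). (i + m, i, j - i)"]) (auto simp: algebra_simps)
  also have "\<dots> = (\<Sum>r\<le>n. \<Sum>i\<le>r. \<Sum>l\<le>n - r. ?g i (r - i) l (n - r - l))"
    by (simp add: sum.Sigma sum.cartesian_product split_def)
  also have "\<dots> = (fps_graded_eval \<phi> \<beta> a * fps_graded_eval \<phi> \<beta> b) $ n"
    by (auto simp: fps_graded_eval_def fps_mult_nth sum_product power_add mult_ac atLeast0AtMost
        intro!: sum.cong)
  finally show "fps_graded_eval \<phi> \<beta> (a * b) $ n = (fps_graded_eval \<phi> \<beta> a * fps_graded_eval \<phi> \<beta> b) $ n" .
qed

lemma comm_ring_morphism_fps_graded_eval: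
  assumes "comm_ring_morphism \<phi>"
  shows "comm_ring_morphism (fps_graded_eval \<phi> \<beta>)"
proof
  interpret comm_ring_morphism \<phi> by fact
  show "fps_graded_eval \<phi> \<beta> (x + y) = fps_graded_eval \<phi> \<beta> x + fps_graded_eval \<phi> \<beta> y" for x y
    by (rule fps_ext) (simp add: fps_graded_eval_def hom_add algebra_simps sum.distrib)
  show "fps_graded_eval \<phi> \<beta> (x * y) = fps_graded_eval \<phi> \<beta> x * fps_graded_eval \<phi> \<beta> y" for x y
    using assms by (rule fps_graded_eval_mult)
  show "fps_graded_eval \<phi> \<beta> 1 = 1"
    using fps_graded_eval_const[of \<phi> \<beta> 1] by simp
qed

section \<open>Monomials and division by the Fermat polynomial\<close>

text \<open>Submodules of a ring over itself are its ideals, so spans serve as generated ideals in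
  the power series ring.\<close>

interpretation ring_module: Modules.module "(*) :: 'a::comm_ring_1 \<Rightarrow> 'a \<Rightarrow> 'a"
  by unfold_locales (auto simp: algebra_simps)

text \<open>As a simplification rule this would loop with associativity.\<close>

declare ring_module.scale_scale [simp del]

abbreviation ideal_span :: "'a::comm_ring_1 set \<Rightarrow> 'a set" where
  "ideal_span \<equiv> ring_module.span"

lemma ideal_span_mult_mem:
  assumes "a \<in> ideal_span S" "\<And>s. s \<in> S \<Longrightarrow> v * s \<in> ideal_span T"
  shows "v * a \<in> ideal_span T"
  using assms(1)
proof (induction rule: ring_module.span_induct_alt)
  case (step c x y)
  have "c * (v * x) + v * y \<in> ideal_span T"
    by (intro ring_module.span_add ring_module.span_scale assms(2) step)
  then show ?case by (simp add: algebra_simps)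
qed (simp add: ring_module.span_zero)

lemma ideal_span_power_CHAR:
  fixes a :: "'a::idom"
  assumes "CHAR('a) > 0" and q: "q = CHAR('a) ^ e" and "a \<in> ideal_span S"
  shows "a ^ q \<in> ideal_span ((\<lambda>s. s ^ q) ` S)"
  using assms(3)
proof (induction rule: ring_module.span_induct_alt)
  case base
  then show ?case using assms(1) q by (simp add: power_0_left ring_module.span_zero)
next
  case (step c x y)
  have "(c * x + y) ^ q = c ^ q * x ^ q + y ^ q"
    using assms(1) by (simp add: q add_power_CHAR power_mult_distrib)
  moreover have "c ^ q * x ^ q + y ^ q \<in> ideal_span ((\<lambda>s. s ^ q) ` S)"
    using step by (intro ring_module.span_add[OF ring_module.span_scale[OF ring_module.span_base]] imageI)
  ultimately show ?case by simp
qed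

abbreviation fermat_poly :: "nat \<Rightarrow> 'a::field fps3" where
  "fermat_poly N \<equiv> X3 ^ N + Y3 ^ N + Z3 ^ N"

definition YZ_monomials :: "nat \<Rightarrow> 'a::field fps3 set" where
  "YZ_monomials k = {Y3 ^ a * Z3 ^ b | a b. a + b = k}"

definition XYZ_monomials :: "nat \<Rightarrow> 'a::field fps3 set" where
  "XYZ_monomials k = {X3 ^ i * Y3 ^ a * Z3 ^ b | i a b. i + a + b = k}"

lemma X3_power_mult_nth: "(X3 ^ n * f) $ l $ j $ i = (if i < n then 0 else f $ l $ j $ (i - n))"
  by (simp add: X3_def fps_const_power fps_X_power_mult_nth)

lemma Y3_power_mult_nth: "(Y3 ^ n * f) $ l $ j = (if j < n then 0 else f $ l $ (j - n))"
  by (simp add: Y3_def fps_const_power fps_X_power_mult_nth)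

lemma Z3_power_mult_nth: "(Z3 ^ n * f) $ l = (if l < n then 0 else f $ (l - n))"
  by (simp add: Z3_def fps_X_power_mult_nth)

lemmas fps3_power_mult_nth = X3_power_mult_nth Y3_power_mult_nth Z3_power_mult_nth

text \<open>Each nonconstant monomial goes to the outermost variable that it contains. As no
  monomial is shared, the coefficients of the cofactors are shifts of those of \<open>f\<close>, and
  vanishing conditions pass to them.\<close>

lemma fps3_decompose:
  fixes f :: "'a::field fps3"
  obtains g1 g2 g3 where "f = fps_const (fps_const (fps_const (f $ 0 $ 0 $ 0))) + X3 * g1 + Y3 * g2 + Z3 * g3"
    and "\<And>l j i. g1 $ l $ j $ i = (if l = 0 \<and> j = 0 then f $ 0 $ 0 $ Suc i else 0)"
    and "\<And>l j i. g2 $ l $ j $ i = (if l = 0 then f $ 0 $ Suc j $ i else 0)"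
    and "\<And>l j i. g3 $ l $ j $ i = f $ Suc l $ j $ i"
proof
  let ?g1 = "fps_const (fps_const (fps_shift 1 (f $ 0 $ 0)))"
  let ?g2 = "fps_const (fps_shift 1 (f $ 0))"
  let ?g3 = "fps_shift 1 f"
  show "f = fps_const (fps_const (fps_const (f $ 0 $ 0 $ 0))) + X3 * ?g1 + Y3 * ?g2 + Z3 * ?g3"
  proof (intro fps_ext)
    fix l j i
    show "f $ l $ j $ i = (fps_const (fps_const (fps_const (f $ 0 $ 0 $ 0))) + X3 * ?g1 + Y3 * ?g2
        + Z3 * ?g3) $ l $ j $ i"
      by (cases l; cases j; cases i) (simp_all add: X3_def Y3_def Z3_def)
  qed
qed auto

lemma mult_YZ_monomials:
  assumes "s \<in> YZ_monomials k"
  shows "Y3 * s \<in> YZ_monomials (Suc k)" "Z3 * s \<in> YZ_monomials (Suc k)"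
proof -
  from assms obtain a b where s: "s = Y3 ^ a * Z3 ^ b" and k: "a + b = k"
    by (auto simp: YZ_monomials_def)
  have "Y3 * s = Y3 ^ Suc a * Z3 ^ b" "Suc a + b = Suc k"
    "Z3 * s = Y3 ^ a * Z3 ^ Suc b" "a + Suc b = Suc k"
    using k by (simp_all add: s mult_ac)
  then show "Y3 * s \<in> YZ_monomials (Suc k)" "Z3 * s \<in> YZ_monomials (Suc k)"
    unfolding YZ_monomials_def by blast+
qed

lemma mult_XYZ_monomials:
  assumes "s \<in> XYZ_monomials k"
  shows "X3 * s \<in> XYZ_monomials (Suc k)" "Y3 * s \<in> XYZ_monomials (Suc k)"
    "Z3 * s \<in> XYZ_monomials (Suc k)"
proof -
  from assms obtain i a b where s: "s = X3 ^ i * Y3 ^ a * Z3 ^ b" and k: "i + a + b = k"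
    by (auto simp: XYZ_monomials_def)
  have "X3 * s = X3 ^ Suc i * Y3 ^ a * Z3 ^ b" "Suc i + a + b = Suc k"
    "Y3 * s = X3 ^ i * Y3 ^ Suc a * Z3 ^ b" "i + Suc a + b = Suc k"
    "Z3 * s = X3 ^ i * Y3 ^ a * Z3 ^ Suc b" "i + a + Suc b = Suc k"
    using k by (simp_all add: s mult_ac)
  then show "X3 * s \<in> XYZ_monomials (Suc k)" "Y3 * s \<in> XYZ_monomials (Suc k)"
    "Z3 * s \<in> XYZ_monomials (Suc k)"
    unfolding XYZ_monomials_def by blast+
qed

text \<open>A series with infinitely many terms is not a finite combination of its monomials.
  Instead, one variable is split off at a time, by induction on \<open>k\<close>.\<close>

lemma in_ideal_span_YZ_monomials:
  assumes "\<And>l j. j + l < k \<Longrightarrow> f $ l $ j = 0"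
  shows "f \<in> ideal_span (YZ_monomials k)"
  using assms
proof (induction k arbitrary: f)
  case 0
  have "f * 1 \<in> ideal_span (YZ_monomials 0)"
    by (intro ring_module.span_scale ring_module.span_base) (simp add: YZ_monomials_def)
  then show ?case by simp
next
  case (Suc k)
  obtain g1 g2 g3 where f: "f = fps_const (fps_const (fps_const (f $ 0 $ 0 $ 0))) + X3 * g1 + Y3 * g2 + Z3 * g3"
    and g1: "\<And>l j i. g1 $ l $ j $ i = (if l = 0 \<and> j = 0 then f $ 0 $ 0 $ Suc i else 0)"
    and g2: "\<And>l j i. g2 $ l $ j $ i = (if l = 0 then f $ 0 $ Suc j $ i else 0)"
    and g3: "\<And>l j i. g3 $ l $ j $ i = f $ Suc l $ j $ i"
    using fps3_decompose by blast
  have f0: "f $ 0 $ 0 = 0" using Suc.prems by simp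
  have "g1 = 0" by (intro fps_ext) (simp add: g1 f0)
  then have "f = Y3 * g2 + Z3 * g3" using f f0 by simp
  moreover have "g2 \<in> ideal_span (YZ_monomials k)" "g3 \<in> ideal_span (YZ_monomials k)"
    by (auto intro!: Suc.IH fps_ext simp: g2 g3 Suc.prems)
  then have "Y3 * g2 + Z3 * g3 \<in> ideal_span (YZ_monomials (Suc k))"
    by (intro ring_module.span_add)
      (erule ideal_span_mult_mem, rule ring_module.span_base, erule mult_YZ_monomials)+
  ultimately show ?case by simp
qed

lemma in_ideal_span_XYZ_monomials:
  assumes "\<And>l j i. i + j + l < k \<Longrightarrow> f $ l $ j $ i = 0"
  shows "f \<in> ideal_span (XYZ_monomials k)"
  using assms
proof (induction k arbitrary: f)
  case 0
  have "f * 1 \<in> ideal_span (XYZ_monomials 0)"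
    by (intro ring_module.span_scale ring_module.span_base) (simp add: XYZ_monomials_def)
  then show ?case by simp
next
  case (Suc k)
  obtain g1 g2 g3 where f: "f = fps_const (fps_const (fps_const (f $ 0 $ 0 $ 0))) + X3 * g1 + Y3 * g2 + Z3 * g3"
    and g1: "\<And>l j i. g1 $ l $ j $ i = (if l = 0 \<and> j = 0 then f $ 0 $ 0 $ Suc i else 0)"
    and g2: "\<And>l j i. g2 $ l $ j $ i = (if l = 0 then f $ 0 $ Suc j $ i else 0)"
    and g3: "\<And>l j i. g3 $ l $ j $ i = f $ Suc l $ j $ i"
    using fps3_decompose by blast
  have "f = X3 * g1 + Y3 * g2 + Z3 * g3" using f Suc.prems by simp
  moreover have "g1 \<in> ideal_span (XYZ_monomials k)" "g2 \<in> ideal_span (XYZ_monomials k)"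
    "g3 \<in> ideal_span (XYZ_monomials k)"
    by (auto intro!: Suc.IH simp: g1 g2 g3 Suc.prems)
  then have "X3 * g1 + Y3 * g2 + Z3 * g3 \<in> ideal_span (XYZ_monomials (Suc k))"
    by (intro ring_module.span_add)
      (erule ideal_span_mult_mem, rule ring_module.span_base, erule mult_XYZ_monomials)+
  ultimately show ?case by simp
qed

text \<open>The equation \<open>q(l,j,i) + q(l,j-N,i+N) + q(l-N,j,i+N) = f(l,j,i+N)\<close> for the
  coefficients of the quotient, solved for its first term.\<close>

function fermat_quotient_coeff :: "nat \<Rightarrow> 'a::field fps3 \<Rightarrow> nat \<Rightarrow> nat \<Rightarrow> nat \<Rightarrow> 'a" where
  "fermat_quotient_coeff N f l j i = f $ l $ j $ (i + N)
     - (if N > 0 \<and> N \<le> j then fermat_quotient_coeff N f l (j - N) (i + N) else 0)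
     - (if N > 0 \<and> N \<le> l then fermat_quotient_coeff N f (l - N) j (i + N) else 0)"
  by auto
termination by (relation "measure (\<lambda>(N, f, l, j, i). l + j)") auto

declare fermat_quotient_coeff.simps [simp del]

text \<open>Weierstrass division with respect to \<open>X\<close>: the recursive quotient
  coefficients are those that cancel every remainder coefficient with \<open>X\<close>-exponent at
  least \<open>N\<close>.\<close>

lemma fermat_division:
  fixes f :: "'a::field fps3"
  assumes "N > 0"
  obtains q r where "f = fermat_poly N * q + r" "\<And>l j i. i \<ge> N \<Longrightarrow> r $ l $ j $ i = 0"
proof
  define q where "q = Abs_fps (\<lambda>l. Abs_fps (\<lambda>j. Abs_fps (\<lambda>i. fermat_quotient_coeff N f l j i)))"
  show "f = fermat_poly N * q + (f - fermat_poly N * q)" by simp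
  show "(f - fermat_poly N * q) $ l $ j $ i = 0" if i: "i \<ge> N" for l j i
    using i assms fermat_quotient_coeff.simps[of N f l j "i - N"]
    by (simp add: distrib_right fps3_power_mult_nth q_def)
qed

text \<open>The map into \<open>K[[\<tau>]][[T]]\<close>, with the inner series variable as
  \<open>\<tau>\<close> and the outer one as \<open>T\<close>. The nested evaluations treat
  \<open>X\<close>, \<open>Y\<close>, \<open>Z\<close> in this order, with weights
  \<open>\<tau>\<close>, \<open>t\<close>, \<open>1\<close>.\<close>

definition branch_eval :: "'a::field alg_closure fps \<Rightarrow> 'a fps3 \<Rightarrow> 'a alg_closure fps fps" where
  "branch_eval t = fps_graded_eval
     (fps_graded_eval (fps_graded_eval (\<lambda>c. fps_const (fps_const (to_ac c))) fps_X) t) 1"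

lemma comm_ring_morphism_branch_eval: "comm_ring_morphism (branch_eval t)"
  unfolding branch_eval_def
  by (intro comm_ring_morphism_fps_graded_eval, unfold_locales)
    (auto simp: fps_const_add[symmetric] fps_const_mult[symmetric] simp del: fps_const_add fps_const_mult)

interpretation branch_eval: comm_ring_morphism "branch_eval t" for t
  by (rule comm_ring_morphism_branch_eval)

lemma branch_eval_nth:
  "branch_eval t f $ n
    = (\<Sum>l\<le>n. \<Sum>j\<le>n - l. fps_const (to_ac (f $ l $ j $ (n - l - j))) * fps_X ^ (n - l - j) * t ^ j)"
proof -
  have "fps_graded_eval (\<lambda>c. fps_const (fps_const (to_ac c))) fps_X a $ m
      = fps_const (to_ac (a $ m)) * fps_X ^ m" for a :: "'a fps" and m
  proof -
    have "(\<Sum>j\<le>m. fps_const (fps_const (to_ac (a $ j))) $ (m - j) * fps_X ^ j)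
        = (\<Sum>j\<in>{m}. fps_const (fps_const (to_ac (a $ j))) $ (m - j) * fps_X ^ j)"
      by (intro sum.mono_neutral_right) auto
    then show ?thesis by (simp add: fps_graded_eval_def)
  qed
  then show ?thesis by (simp add: branch_eval_def fps_graded_eval_def[of _ t] fps_graded_eval_def[of _ 1])
qed

lemma branch_eval_X3: "branch_eval t X3 = fps_const fps_X * fps_X"
  and branch_eval_Y3: "branch_eval t Y3 = fps_const t * fps_X"
  and branch_eval_Z3: "branch_eval t Z3 = fps_X"
proof -
  let ?f0 = "\<lambda>c::'a. fps_const (fps_const (to_ac c))"
  have 0: "comm_ring_morphism ?f0"
    by unfold_locales
      (auto simp: fps_const_add[symmetric] fps_const_mult[symmetric] simp del: fps_const_add fps_const_mult)
  note 1 = comm_ring_morphism_fps_graded_eval[OF 0, of fps_X]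
  note 2 = comm_ring_morphism_fps_graded_eval[OF 1, of t]
  note [simp] = comm_ring_morphism.hom_0[OF 0] comm_ring_morphism.hom_0[OF 1] comm_ring_morphism.hom_0[OF 2]
  show "branch_eval t X3 = fps_const fps_X * fps_X"
    by (simp add: branch_eval_def X3_def fps_graded_eval_const fps_graded_eval_X[OF 0])
  show "branch_eval t Y3 = fps_const t * fps_X"
    by (simp add: branch_eval_def Y3_def fps_graded_eval_const fps_graded_eval_X[OF 1])
  show "branch_eval t Z3 = fps_X"
    by (simp add: branch_eval_def Z3_def fps_graded_eval_X[OF 2])
qed

section \<open>Embedding the Fermat ring and the upper bound\<close>

text \<open>The coefficient of \<open>T^n\<close> is the homogeneous part of degree \<open>n\<close>, evaluated at
  \<open>(X, t, 1)\<close>.\<close>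

lemma branch_eval_nth_in_span:
  "branch_eval t f $ n \<in> fps_vs.span ((\<lambda>(i, j). fps_X ^ i * t ^ j) ` ({..n} \<times> {..n}))"
proof -
  have "fps_const c * (fps_X ^ (n - l - j) * t ^ j)
      \<in> fps_vs.span ((\<lambda>(i, j). fps_X ^ i * t ^ j) ` ({..n} \<times> {..n}))" if "l \<le> n" "j \<le> n - l" for c l j
    using that by (intro fps_vs.span_scale fps_vs.span_base image_eqI[where x = "(n - l - j, j)"]) auto
  then show ?thesis
    unfolding branch_eval_nth by (intro fps_vs.span_sum) (simp add: mult.assoc)
qed

locale fermat_branch =
  fixes N :: nat and t :: "'a::field alg_closure fps"
  assumes N_pos: "N > 0"
    and fermat_eq: "fps_X ^ N + t ^ N + 1 = 0"
    and supported: "\<And>n. \<not> N dvd n \<Longrightarrow> t $ n = 0"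
begin

lemma t_nonconstant: "t \<noteq> fps_const (t $ 0)"
proof
  assume t: "t = fps_const (t $ 0)"
  have "(fps_X ^ N + t ^ N + 1) $ N = 0" unfolding fermat_eq by simp
  moreover have "(t ^ N) $ N = 0" using N_pos by (subst t) (simp add: fps_const_power)
  ultimately show False using N_pos by simp
qed

lemma branch_eval_fermat_poly: "branch_eval t (fermat_poly N) = 0"
proof -
  have "branch_eval t (fermat_poly N) = fps_const (fps_X ^ N + t ^ N + 1) * fps_X ^ N"
    by (simp add: branch_eval.hom_add branch_eval.hom_power branch_eval_X3 branch_eval_Y3 branch_eval_Z3
        power_mult_distrib fps_const_power distrib_right flip: fps_const_add fps_const_1_eq_1)
  then show ?thesis by (simp add: fermat_eq)
qed

text \<open>The exponents of \<open>x\<close> modulo \<open>N\<close> separate the summands \<open>x^i G(t)\<close>, \<open>i < N\<close>.\<close>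

lemma coeff_eq_0_if_branch_eval_residue_class_eq_0:
  fixes f :: "'a fps3"
  assumes red: "\<And>l j i. i \<ge> N \<Longrightarrow> f $ l $ j $ i = 0"
    and i0: "i0 < N" and n: "l0 + j0 + i0 = n"
    and vanish: "\<And>m. m mod N = i0 \<Longrightarrow> branch_eval t f $ n $ m = 0"
  shows "f $ l0 $ j0 $ i0 = 0"
proof -
  define a where "a i j = to_ac (f $ (n - i - j) $ j $ i)" for i j
  \<comment> \<open>The cofactor of \<open>X^i\<close> in the part of degree \<open>n\<close>, a
    polynomial in \<open>t\<close> and therefore a series in \<open>X^N\<close>.\<close>
  define G where "G i = (\<Sum>j\<le>n - i. fps_const (a i j) * t ^ j)" for i
  have "branch_eval t f $ n
      = (\<Sum>(l, j)\<in>Sigma {..n} (\<lambda>l. {..n - l}).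
          fps_const (to_ac (f $ l $ j $ (n - l - j))) * fps_X ^ (n - l - j) * t ^ j)"
    unfolding branch_eval_nth by (simp add: sum.Sigma)
  also have "\<dots> = (\<Sum>(i, j)\<in>Sigma {..n} (\<lambda>i. {..n - i}). fps_const (a i j) * fps_X ^ i * t ^ j)"
    unfolding a_def
    by (rule sum.reindex_bij_witness[where i = "\<lambda>(i, j). (n - i - j, j)" and j = "\<lambda>(l, j). (n - l - j, j)"])
      auto
  also have "\<dots> = (\<Sum>i\<le>n. fps_X ^ i * G i)"
    by (simp add: G_def sum.Sigma[symmetric] sum_distrib_left mult_ac)
  finally have eval: "branch_eval t f $ n = (\<Sum>i\<le>n. fps_X ^ i * G i)" .
  have G_supp: "G i $ m = 0" if "\<not> N dvd m" for i m
    using fps_power_supported_on_multiples[of N t, OF supported that] by (simp add: G_def fps_sum_nth)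
  have G_red: "G i = 0" if "i \<ge> N" for i
    using red[OF that] by (simp add: G_def a_def)
  have "G i0 $ m = 0" for m
  proof (cases "N dvd m")
    case True
    then have "(i0 + m) mod N = i0" using i0 by (auto elim: dvdE)
    \<comment> \<open>At exponent \<open>i0 + m\<close> only indices \<open>i\<close> congruent to
      \<open>i0\<close> modulo \<open>N\<close> can contribute. Since \<open>G i = 0\<close> for
      \<open>i \<ge> N\<close>, only \<open>i = i0\<close> remains.\<close>
    then have "0 = (\<Sum>i\<le>n. (fps_X ^ i * G i) $ (i0 + m))"
      using vanish[of "i0 + m"] by (simp add: eval fps_sum_nth)
    also have "\<dots> = (\<Sum>i\<in>{i0}. (fps_X ^ i * G i) $ (i0 + m))"
    proof (intro sum.mono_neutral_right ballI)
      show "{i0} \<subseteq> {..n}" using n by simp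
      fix i assume i: "i \<in> {..n} - {i0}"
      show "(fps_X ^ i * G i) $ (i0 + m) = 0"
      proof (cases "i < N \<and> i \<le> i0 + m")
        case True
        have "\<not> N dvd i0 + m - i"
        proof
          assume "N dvd i0 + m - i"
          then have "i mod N = (i0 + m) mod N" using True by (metis mod_eq_dvd_iff_nat)
          then show False using \<open>(i0 + m) mod N = i0\<close> True i by simp
        qed
        then show ?thesis using G_supp by (simp add: fps_X_power_mult_nth)
      next
        case False
        then show ?thesis using G_red by (auto simp: fps_X_power_mult_nth not_less)
      qed
    qed simp
    finally show ?thesis by (simp add: fps_X_power_mult_nth)
  qed (rule G_supp)
  then have "(\<Sum>j\<le>n - i0. fps_const (a i0 j) * t ^ j) = 0"
    unfolding G_def[symmetric] by (intro fps_ext) simp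
  then have "a i0 j0 = 0"
    by (rule nonconstant_fps_transcendental[OF t_nonconstant]) (use n in simp)
  moreover have "n - i0 - j0 = l0" using n by simp
  ultimately show ?thesis by (simp add: a_def)
qed

lemma branch_eval_nth_eq_0_imp:
  assumes "\<And>l j i. i \<ge> N \<Longrightarrow> f $ l $ j $ i = 0" and "branch_eval t f $ n = 0" "l + j + i = n"
  shows "f $ l $ j $ i = 0"
  using assms(1) coeff_eq_0_if_branch_eval_residue_class_eq_0[OF assms(1), of i l j n] assms(2,3)
  by (cases "i < N") auto

text \<open>Remainders of the division are determined by their images, so the kernel is exactly the
  ideal of the Fermat polynomial. Its primality follows at once, because the target is a
  domain.\<close>

lemma fermat_poly_dvd_iff: "fermat_poly N dvd f \<longleftrightarrow> branch_eval t f = 0"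
proof
  assume "fermat_poly N dvd f"
  then show "branch_eval t f = 0"
    by (auto simp: branch_eval.hom_mult branch_eval_fermat_poly elim!: dvdE)
next
  assume *: "branch_eval t f = 0"
  obtain q r where f: "f = fermat_poly N * q + r" and r: "\<And>l j i. i \<ge> N \<Longrightarrow> r $ l $ j $ i = 0"
    using fermat_division[OF N_pos] by blast
  have "branch_eval t f = branch_eval t (fermat_poly N) * branch_eval t q + branch_eval t r"
    unfolding f by (simp only: branch_eval.hom_add[of t "fermat_poly N * q"]
        branch_eval.hom_mult[of t "fermat_poly N"])
  then have "branch_eval t r = 0"
    using * by (simp only: branch_eval_fermat_poly mult_zero_left add_0_left)
  then have "r = 0"
    by (intro fps_ext) (simp add: branch_eval_nth_eq_0_imp[OF r])
  then show "fermat_poly N dvd f" by (simp add: f)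
qed

lemma fermat_poly_dvd_mult_iff:
  "fermat_poly N dvd (f :: 'a fps3) * g \<longleftrightarrow> fermat_poly N dvd f \<or> fermat_poly N dvd g"
  by (simp add: fermat_poly_dvd_iff branch_eval.hom_mult)

text \<open>For \<open>n = N\<close> this admits the multiplier used in the lower bound; for
  \<open>n = 0\<close> it makes the quotient nontrivial.\<close>

lemma Y3_power_not_dvd: "\<not> fermat_poly N dvd (Y3 :: 'a fps3) ^ n"
proof -
  have "t \<noteq> 0" using t_nonconstant by (metis fps_const_0_eq_0 fps_zero_nth)
  then show ?thesis
    by (simp add: fermat_poly_dvd_iff branch_eval.hom_power branch_eval_Y3)
qed

end

lemma fermat_branch_exists_if_CHAR_not_dvd:
  assumes "\<not> CHAR('a::field) dvd N"
  shows "\<exists>t :: 'a alg_closure fps. fermat_branch N t"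
proof -
  have "N > 0" using assms by (intro Nat.gr0I) auto
  moreover have "of_nat N \<noteq> (0 :: 'a alg_closure)"
    using assms by (simp add: of_nat_eq_0_iff_char_dvd)
  ultimately show ?thesis
    using fermat_branch_exists[of N, where 'a = "'a alg_closure"] by (auto simp: fermat_branch_def)
qed

section \<open>Upper bound for the tight closure\<close>

lemma in_ideal_span_YZ_powersE:
  assumes "g \<in> ideal_span ((\<lambda>s. s ^ q) ` YZ_monomials k)"
  obtains s where "g = (\<Sum>a\<le>k. s a * (Y3 ^ (a * q) * Z3 ^ ((k - a) * q)))"
proof -
  have "\<exists>s. g = (\<Sum>a\<le>k. s a * (Y3 ^ (a * q) * Z3 ^ ((k - a) * q)))"
    using assms
  proof (induction rule: ring_module.span_induct_alt)
    case base
    show ?case by (intro exI[of _ "\<lambda>_. 0"]) simp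
  next
    case (step c x y)
    then obtain s where y: "y = (\<Sum>a\<le>k. s a * (Y3 ^ (a * q) * Z3 ^ ((k - a) * q)))" by blast
    from step obtain b b' where "x = (Y3 ^ b * Z3 ^ b') ^ q" "b + b' = k"
      by (auto simp: YZ_monomials_def)
    then have b: "b \<le> k" and x: "x = Y3 ^ (b * q) * Z3 ^ ((k - b) * q)"
      by (auto simp: power_mult_distrib power_mult)
    have "c * x = (\<Sum>a\<le>k. (if a = b then c else 0) * (Y3 ^ (a * q) * Z3 ^ ((k - a) * q)))"
      using b by (simp add: x if_distrib[of "\<lambda>z. z * _"] cong: if_cong)
    then have "c * x + y = (\<Sum>a\<le>k. ((if a = b then c else 0) + s a) * (Y3 ^ (a * q) * Z3 ^ ((k - a) * q)))"
      by (simp add: y distrib_right sum.distrib)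
    then show ?case by (intro exI[of _ "\<lambda>a. (if a = b then c else 0) + s a"])
  qed
  then show ?thesis using that by blast
qed

text \<open>For \<open>d = k\<close> the degree of the coefficients is \<open>\<delta>\<close>, independently of \<open>q\<close>.\<close>

lemma (in fermat_branch) leading_coeff_relation:
  fixes c f :: "'a fps3"
  assumes CHAR: "CHAR('a) > 0" and q: "q = CHAR('a) ^ e"
    and rel: "fermat_poly N dvd c * f ^ q - g" "g \<in> ideal_span ((\<lambda>s. s ^ q) ` YZ_monomials k)"
    and ord: "\<And>n. n < d \<Longrightarrow> branch_eval t f $ n = 0" "\<And>n. n < \<delta> \<Longrightarrow> branch_eval t c $ n = 0"
  obtains s where "branch_eval t c $ \<delta> * (branch_eval t f $ d) ^ q
      = (if \<delta> + d * q < k * q then 0 else \<Sum>a\<le>k. branch_eval t (s a) $ (\<delta> + d * q - k * q) * (t ^ a) ^ q)"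
proof -
  have q0: "q > 0" using CHAR q by simp
  obtain s where g: "g = (\<Sum>a\<le>k. s a * (Y3 ^ (a * q) * Z3 ^ ((k - a) * q)))"
    using in_ideal_span_YZ_powersE[OF rel(2)] .
  define c' where "c' = fps_shift \<delta> (branch_eval t c)"
  define f' where "f' = fps_shift d (branch_eval t f)"
  have c': "branch_eval t c = fps_X ^ \<delta> * c'"
    using ord(2) by (intro fps_ext) (simp add: c'_def fps_X_power_mult_nth)
  have f': "branch_eval t f = fps_X ^ d * f'"
    using ord(1) by (intro fps_ext) (simp add: f'_def fps_X_power_mult_nth)
  have "branch_eval t c * branch_eval t f ^ q = fps_X ^ (\<delta> + d * q) * (c' * f' ^ q)"
    by (simp add: c' f' power_mult_distrib power_add power_mult mult_ac)
  moreover have "(f' ^ q) $ 0 = (f' $ 0) ^ q" by (simp add: fps_power_zeroth)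
  ultimately have lhs: "(branch_eval t c * branch_eval t f ^ q) $ (\<delta> + d * q)
      = branch_eval t c $ \<delta> * (branch_eval t f $ d) ^ q"
    by (simp add: fps_X_power_mult_nth fps_mult_nth_0 c'_def f'_def)
  have "branch_eval t (c * f ^ q) = branch_eval t g"
    using rel(1) by (simp add: fermat_poly_dvd_iff branch_eval.hom_diff)
  \<comment> \<open>All generators map to multiples of the same power \<open>T^(k q)\<close>,
    distinguished only by the factors \<open>(t^a)^q\<close>.\<close>
  also have "\<dots> = (\<Sum>a\<le>k. branch_eval t (s a) * (fps_const (t ^ (a * q)) * fps_X ^ (k * q)))"
    unfolding g branch_eval.hom_sum
  proof (rule sum.cong)
    fix a assume "a \<in> {..k}"
    then have "k * q = a * q + (k - a) * q" by (simp flip: add_mult_distrib)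
    then show "branch_eval t (s a * (Y3 ^ (a * q) * Z3 ^ ((k - a) * q)))
        = branch_eval t (s a) * (fps_const (t ^ (a * q)) * fps_X ^ (k * q))"
      by (simp only: branch_eval.hom_mult branch_eval.hom_power branch_eval_Y3 branch_eval_Z3
          power_mult_distrib fps_const_power power_add mult_ac)
  qed simp
  also have "\<dots> = fps_X ^ (k * q) * (\<Sum>a\<le>k. fps_const ((t ^ a) ^ q) * branch_eval t (s a))"
    by (simp add: sum_distrib_left mult_ac power_mult)
  finally have "branch_eval t c * branch_eval t f ^ q
      = fps_X ^ (k * q) * (\<Sum>a\<le>k. fps_const ((t ^ a) ^ q) * branch_eval t (s a))"
    by (simp add: branch_eval.hom_mult branch_eval.hom_power)
  then show ?thesis
    using lhs by (intro that[of s]) (auto simp: fps_X_power_mult_nth fps_sum_nth mult.commute intro!: sum.cong)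
qed

text \<open>Modulo the Fermat polynomial and \<open>(Y, Z)^k\<close>, \<open>f\<close> is
  represented by some \<open>r1\<close>. A term of \<open>r1\<close> of degree at most
  \<open>k\<close> would give its image a nonzero leading coefficient \<open>u\<close>, which the
  tight closure relation forces to vanish.\<close>

lemma fermat_tight_closure_upper_bound:
  fixes c f :: "'a::field fps3"
  assumes CHAR: "CHAR('a) > 0" "\<not> CHAR('a) dvd N"
    and c: "\<not> fermat_poly N dvd c"
    and tight: "\<And>e. e \<ge> e0 \<Longrightarrow> \<exists>g \<in> ideal_span ((\<lambda>s. s ^ (CHAR('a) ^ e)) ` YZ_monomials k).
                  fermat_poly N dvd c * f ^ (CHAR('a) ^ e) - g"
  shows "\<exists>g \<in> ideal_span (XYZ_monomials (k + 1) \<union> YZ_monomials k). fermat_poly N dvd f - g"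
proof -
  obtain t where "fermat_branch N (t :: 'a alg_closure fps)"
    using fermat_branch_exists_if_CHAR_not_dvd[OF CHAR(2)] by blast
  then interpret fermat_branch N t .
  obtain Q r where f: "f = fermat_poly N * Q + r" and r: "\<And>l j i. i \<ge> N \<Longrightarrow> r $ l $ j $ i = 0"
    using fermat_division[OF N_pos] by blast
  \<comment> \<open>Only terms of degree below \<open>k\<close> in \<open>Y\<close> and
    \<open>Z\<close> are kept, so every monomial of total degree \<open>k\<close> left in
    \<open>r1\<close> contains \<open>X\<close>.\<close>
  define r1 where "r1 = Abs_fps (\<lambda>l. Abs_fps (\<lambda>j. if j + l < k then r $ l $ j else 0))"
  have r1: "\<And>l j i. i \<ge> N \<Longrightarrow> r1 $ l $ j $ i = 0" by (simp add: r1_def r)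
  have r2: "r - r1 \<in> ideal_span (YZ_monomials k)"
    by (intro in_ideal_span_YZ_monomials) (auto simp: r1_def)
  have "r1 $ l $ j $ i = 0" if "i + j + l < k + 1" for l j i
  proof (rule ccontr)
    assume nz: "r1 $ l $ j $ i \<noteq> 0"
    define d where "d = (LEAST d. branch_eval t r1 $ d \<noteq> 0)"
    have bnz: "branch_eval t r1 $ (l + j + i) \<noteq> 0"
      using nz branch_eval_nth_eq_0_imp[OF r1] by blast
    define u where "u = branch_eval t r1 $ d"
    have u0: "u \<noteq> 0" unfolding u_def d_def by (rule LeastI[of "\<lambda>d. branch_eval t r1 $ d \<noteq> 0", OF bnz])
    have d_le: "d \<le> k" using Least_le[of "\<lambda>d. branch_eval t r1 $ d \<noteq> 0", OF bnz] that by (simp add: d_def)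
    have d_ord: "branch_eval t r1 $ n = 0" if "n < d" for n
      using not_less_Least[of n "\<lambda>d. branch_eval t r1 $ d \<noteq> 0"] that by (auto simp: d_def)
    define \<delta> where "\<delta> = subdegree (branch_eval t c)"
    define C where "C = branch_eval t c $ \<delta>"
    have C0: "C \<noteq> 0" using c by (simp add: C_def \<delta>_def fermat_poly_dvd_iff)
    define V where "V = fps_vs.span ((\<lambda>(i, j). fps_X ^ i * t ^ j) ` ({..\<delta>} \<times> {..\<delta>}))"
    have V: "branch_eval t g $ \<delta> \<in> V" for g unfolding V_def by (rule branch_eval_nth_in_span)
    obtain B where B: "\<And>v. v \<in> V \<Longrightarrow> \<forall>n<B. v $ n = 0 \<Longrightarrow> v = 0"
      using finite_span_subdegree_bound[of "(\<lambda>(i, j). fps_X ^ i * t ^ j) ` ({..\<delta>} \<times> {..\<delta>})"]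
      by (auto simp: V_def)
    \<comment> \<open>\<open>V\<close> and \<open>B\<close> depend on \<open>c\<close> only through
      \<open>\<delta>\<close>, so \<open>q\<close> may be chosen afterwards, beyond both
      \<open>B\<close> and \<open>\<delta>\<close>.\<close>
    define e where "e = e0 + B + \<delta>"
    define q where "q = CHAR('a) ^ e"
    have "CHAR('a) \<ge> 2" using CHAR(1) prime_CHAR_semidom[where ?'a = 'a] prime_ge_2_nat by blast
    then have "e < q" unfolding q_def using less_exp[of e] power_mono[of 2 "CHAR('a)" e] by linarith
    then have Bq: "B \<le> q" and \<delta>q: "\<delta> < q" by (auto simp: e_def)
    have CHAR': "CHAR('a alg_closure) > 0" "q = CHAR('a alg_closure) ^ e"
      "CHAR('a fps3) > 0" "q = CHAR('a fps3) ^ e"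
      using CHAR by (auto simp: q_def)
    obtain g where g: "g \<in> ideal_span ((\<lambda>s. s ^ q) ` YZ_monomials k)" "fermat_poly N dvd c * f ^ q - g"
      using tight[of e] by (auto simp: q_def e_def)
    \<comment> \<open>Frobenius separates the three parts of \<open>f\<close>. The first is a
      multiple of the Fermat polynomial and the last is absorbed into \<open>g\<close>, so the
      relation passes to \<open>r1\<close>.\<close>
    have "f ^ q = (fermat_poly N * Q) ^ q + (r1 ^ q + (r - r1) ^ q)"
      using add_power_CHAR[of "fermat_poly N * Q" r, OF CHAR'(3)] add_power_CHAR[of r1 "r - r1", OF CHAR'(3)]
      by (simp add: f CHAR'(4))
    then have "c * r1 ^ q - (g - c * (r - r1) ^ q) = (c * f ^ q - g) - c * (fermat_poly N * Q) ^ q"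
      by (simp add: algebra_simps)
    moreover have "fermat_poly N dvd c * (fermat_poly N * Q) ^ q"
      using \<delta>q by (intro dvd_mult dvd_trans[OF dvd_triv_left dvd_power]) simp
    ultimately have rel: "fermat_poly N dvd c * r1 ^ q - (g - c * (r - r1) ^ q)"
      using g(2) by (metis dvd_diff)
    have rel2: "g - c * (r - r1) ^ q \<in> ideal_span ((\<lambda>s. s ^ q) ` YZ_monomials k)"
      using g(1) ideal_span_power_CHAR[OF CHAR'(3,4) r2]
      by (intro ring_module.span_diff ring_module.span_scale)
    have c_ord: "branch_eval t c $ n = 0" if "n < \<delta>" for n
      using that unfolding \<delta>_def by (rule nth_less_subdegree_zero)
    obtain s where s: "C * u ^ q
      = (if \<delta> + d * q < k * q then 0 else \<Sum>a\<le>k. branch_eval t (s a) $ (\<delta> + d * q - k * q) * (t ^ a) ^ q)"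
      unfolding C_def u_def using leading_coeff_relation[OF CHAR(1) q_def rel rel2 d_ord c_ord] by blast
    have "d = k"
    proof (rule ccontr)
      assume "d \<noteq> k"
      \<comment> \<open>With \<open>\<delta> < q\<close> this gives
        \<open>\<delta> + d q < k q\<close>, the zero case of the relation.\<close>
      then have "(d + 1) * q \<le> k * q" using d_le by (intro mult_le_mono1) simp
      then have "C * u ^ q = 0" using s \<delta>q by simp
      then show False using C0 u0 by simp
    qed
    then have s': "C * u ^ q = (\<Sum>a\<le>k. branch_eval t (s a) $ \<delta> * (t ^ a) ^ q)" using s by simp
    \<comment> \<open>The powers \<open>t^a\<close> are series in \<open>X^N\<close>, and the
      coefficientwise comparison hands this support on to \<open>u\<close>.\<close>
    have u_supp: "u $ m = 0" if "\<not> N dvd m" for m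
    proof (rule coefficients_vanish_if_power_combination[OF CHAR'(1,2) Bq _ B _ C0 _ s'])
      show "fps_vs.subspace V" by (simp add: V_def)
      show "C \<in> V" by (simp add: C_def V)
      show "(t ^ a) $ m = 0" for a using fps_power_supported_on_multiples[of N t, OF supported that] .
    qed (auto simp: V)
    \<comment> \<open>Terms without \<open>X\<close> were removed from \<open>r1\<close>. For
      \<open>0 < i' < N\<close> the residue class of \<open>i'\<close> contains no multiple of
      \<open>N\<close>, so \<open>u\<close> vanishes on all of it.\<close>
    have deg_d: "r1 $ l' $ j' $ i' = 0" if "l' + j' + i' = d" for l' j' i'
    proof (cases "i' = 0")
      case True
      then show ?thesis using that \<open>d = k\<close> by (simp add: r1_def)
    next
      case False
      show ?thesis
      proof (cases "i' < N")
        case True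
        have "\<not> N dvd m" if "m mod N = i'" for m using that False by auto
        then show ?thesis
          using coeff_eq_0_if_branch_eval_residue_class_eq_0[OF r1 True that] u_supp by (simp add: u_def)
      qed (simp add: r1)
    qed
    have "u = 0"
      unfolding u_def branch_eval_nth by (auto intro!: sum.neutral simp: deg_d)
    then show False using u0 by simp
  qed
  then have "r1 \<in> ideal_span (XYZ_monomials (k + 1))"
    by (intro in_ideal_span_XYZ_monomials)
  then have "r1 + (r - r1) \<in> ideal_span (XYZ_monomials (k + 1) \<union> YZ_monomials k)"
    using r2 by (intro ring_module.span_add) (auto intro: subsetD[OF ring_module.span_mono, rotated])
  then show ?thesis by (intro bexI[of _ r]) (auto simp: f)
qed

section \<open>Lower bound and reduction\<close>

lemma in_ideal_span_insert_iff:
  "x \<in> ideal_span (insert h S) \<longleftrightarrow> (\<exists>g\<in>ideal_span S. h dvd x - g)"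
proof
  assume "x \<in> ideal_span (insert h S)"
  then obtain k where "x - k * h \<in> ideal_span S" by (auto simp: ring_module.span_insert)
  then show "\<exists>g\<in>ideal_span S. h dvd x - g" by (intro bexI[of _ "x - k * h"]) auto
next
  assume "\<exists>g\<in>ideal_span S. h dvd x - g"
  then obtain g k where "g \<in> ideal_span S" "x - g = h * k" by (auto elim!: dvdE)
  then show "x \<in> ideal_span (insert h S)"
    by (auto simp: ring_module.span_insert algebra_simps intro!: exI[of _ k])
qed

text \<open>Rounding both exponents down to multiples of \<open>q\<close> loses less than
  \<open>2 q\<close> in total, so the two quotients still add up to at least
  \<open>k\<close>.\<close>

lemma in_ideal_span_if_large_exponents:
  fixes q :: nat
  assumes "q > 0" "u + v \<ge> (k + 1) * q"
  shows "(Y3 :: 'a::field fps3) ^ u * Z3 ^ v \<in> ideal_span ((\<lambda>s. s ^ q) ` YZ_monomials k)"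
proof -
  let ?y = "Y3 :: 'a fps3" and ?z = "Z3 :: 'a fps3"
  have "u < u div q * q + q" "v < v div q * q + q"
    using dividend_less_div_times[OF assms(1)] by (simp_all add: add.commute)
  then have "(k + 1) * q < (u div q + v div q + 2) * q"
    using assms(2) unfolding add_mult_distrib by linarith
  then have k: "k \<le> u div q + v div q" by (simp only: mult_less_cancel2) simp
  define a where "a = min (u div q) k"
  have "a \<le> u div q" "k - a \<le> v div q" using k by (auto simp: a_def)
  then have a: "a * q \<le> u" "(k - a) * q \<le> v" using assms(1) by (simp_all add: less_eq_div_iff_mult_less_eq)
  have "(?y ^ a * ?z ^ (k - a)) ^ q \<in> (\<lambda>s. s ^ q) ` YZ_monomials k"
    unfolding YZ_monomials_def
    by (intro imageI CollectI exI[of _ a] exI[of _ "k - a"]) (simp add: a_def)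
  then have "?y ^ (u - a * q) * ?z ^ (v - (k - a) * q) * (?y ^ a * ?z ^ (k - a)) ^ q
      \<in> ideal_span ((\<lambda>s. s ^ q) ` YZ_monomials k)"
    by (intro ring_module.span_scale ring_module.span_base)
  moreover have "?y ^ (u - a * q) * ?z ^ (v - (k - a) * q) * (?y ^ a * ?z ^ (k - a)) ^ q
      = ?y ^ (u - a * q + a * q) * ?z ^ (v - (k - a) * q + (k - a) * q)"
    by (simp only: power_add power_mult[symmetric] power_mult_distrib mult_ac)
  ultimately show ?thesis by (simp only: le_add_diff_inverse2[OF a(1)] le_add_diff_inverse2[OF a(2)])
qed

text \<open>Replacing one factor \<open>X^N\<close> by \<open>- Y^N - Z^N\<close> preserves the
  total degree, so induction on \<open>m\<close> ends at monomials in \<open>Y\<close> and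
  \<open>Z\<close> alone.\<close>

lemma X3_power_mult_in_ideal_span_if_large_exponents:
  fixes q :: nat
  assumes "q > 0" "N * m + u + v \<ge> (k + 1) * q"
  shows "(X3 ^ N) ^ m * (Y3 ^ u * Z3 ^ v)
    \<in> ideal_span (insert (fermat_poly N) ((\<lambda>s. s ^ q) ` YZ_monomials k))" (is "_ \<in> ?E")
  using assms(2)
proof (induction m arbitrary: u v)
  case 0
  have "Y3 ^ u * Z3 ^ v \<in> ideal_span ((\<lambda>s. s ^ q) ` YZ_monomials k)"
    using assms(1) 0 by (intro in_ideal_span_if_large_exponents) auto
  then show ?case using ring_module.span_mono[of _ "insert _ _"] by (simp add: subset_iff) blast
next
  case (Suc m)
  have "(X3 ^ N) ^ m * (Y3 ^ (u + N) * Z3 ^ v) \<in> ?E" "(X3 ^ N) ^ m * (Y3 ^ u * Z3 ^ (v + N)) \<in> ?E"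
    using Suc.IH[of "u + N" v] Suc.IH[of u "v + N"] Suc.prems by simp_all
  moreover have "(X3 ^ N) ^ m * (Y3 ^ u * Z3 ^ v) * fermat_poly N \<in> ?E"
    by (intro ring_module.span_scale ring_module.span_base) simp
  ultimately have "(X3 ^ N) ^ m * (Y3 ^ u * Z3 ^ v) * fermat_poly N
      - (X3 ^ N) ^ m * (Y3 ^ (u + N) * Z3 ^ v) - (X3 ^ N) ^ m * (Y3 ^ u * Z3 ^ (v + N)) \<in> ?E"
    by (intro ring_module.span_diff)
  also have "(X3 ^ N) ^ m * (Y3 ^ u * Z3 ^ v) * fermat_poly N
      - (X3 ^ N) ^ m * (Y3 ^ (u + N) * Z3 ^ v) - (X3 ^ N) ^ m * (Y3 ^ u * Z3 ^ (v + N))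
    = (X3 ^ N) ^ Suc m * (Y3 ^ u * Z3 ^ v)"
    by (simp add: power_add algebra_simps)
  finally show ?case .
qed

text \<open>Reducing \<open>X^(i q)\<close> modulo the relation loses less than \<open>N\<close> in degree, which the
  factor \<open>Y^N\<close> makes up for.\<close>

lemma fermat_tight_closure_lower_bound:
  fixes f :: "'a::field fps3"
  assumes CHAR: "CHAR('a) > 0" and q: "q = CHAR('a) ^ e" and "N > 0"
    and f: "f \<in> ideal_span (XYZ_monomials (k + 1) \<union> YZ_monomials k)"
  shows "Y3 ^ N * f ^ q \<in> ideal_span (insert (fermat_poly N) ((\<lambda>s. s ^ q) ` YZ_monomials k))"
    (is "_ \<in> ?E")
proof -
  have q0: "q > 0" using CHAR q by simp
  have "f ^ q \<in> ideal_span ((\<lambda>s. s ^ q) ` (XYZ_monomials (k + 1) \<union> YZ_monomials k))"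
    using f CHAR q by (intro ideal_span_power_CHAR) auto
  then show ?thesis
  proof (rule ideal_span_mult_mem)
    fix s' :: "'a fps3" assume "s' \<in> (\<lambda>s. s ^ q) ` (XYZ_monomials (k + 1) \<union> YZ_monomials k)"
    then obtain s where s: "s \<in> XYZ_monomials (k + 1) \<union> YZ_monomials k" and s': "s' = s ^ q" by blast
    from s show "Y3 ^ N * s' \<in> ?E"
    proof
      assume "s \<in> YZ_monomials k"
      then show ?thesis unfolding s' by (intro ring_module.span_scale ring_module.span_base) simp
    next
      assume "s \<in> XYZ_monomials (k + 1)"
      then obtain i a b where s: "s = X3 ^ i * Y3 ^ a * Z3 ^ b" and k: "i + a + b = k + 1"
        by (auto simp: XYZ_monomials_def)
      have iq: "i * q = N * (i * q div N) + i * q mod N" "i * q mod N < N" using \<open>N > 0\<close> by simp_all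
      have "N * (i * q div N) + (N + a * q) + b * q \<ge> i * q + a * q + b * q" using iq by linarith
      also have "i * q + a * q + b * q = (k + 1) * q" using k by (simp flip: add_mult_distrib)
      finally have "X3 ^ (i * q mod N) * ((X3 ^ N) ^ (i * q div N) * (Y3 ^ (N + a * q) * Z3 ^ (b * q))) \<in> ?E"
        by (intro ring_module.span_scale X3_power_mult_in_ideal_span_if_large_exponents q0)
      moreover have "X3 ^ (i * q mod N) * (X3 ^ N) ^ (i * q div N) = (X3 :: 'a fps3) ^ (i * q)"
        by (simp flip: power_mult power_add)
      then have "X3 ^ (i * q mod N) * ((X3 ^ N) ^ (i * q div N) * (Y3 ^ (N + a * q) * Z3 ^ (b * q)))
          = Y3 ^ N * s'"
        by (simp add: s' s power_mult_distrib power_add power_mult mult_ac)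
      ultimately show ?thesis by simp
    qed
  qed
qed

section \<open>Multiplication of the filtration by \<open>I\<close>\<close>

text \<open>A monomial containing \<open>Y\<close> or \<open>Z\<close> simply loses one such factor.
  The remaining one, \<open>X^(m + 2)\<close>, is rewritten by the Fermat relation, which requires
  \<open>m + 2 \<ge> N\<close>; this is the origin of the value \<open>N - 2\<close>.\<close>

lemma XYZ_monomials_subset_reduction:
  assumes "N \<ge> 1" "m + 2 \<ge> N"
  shows "XYZ_monomials (m + 2) \<union> YZ_monomials (m + 1)
    \<subseteq> ideal_span (insert (fermat_poly N)
        {u * s | u s. u \<in> {Y3, Z3} \<and> s \<in> XYZ_monomials (m + 1) \<union> YZ_monomials m})" (is "_ \<subseteq> ?E")
proof -
  have prod: "u * s \<in> ?E" if "u \<in> {Y3, Z3}" "s \<in> XYZ_monomials (m + 1) \<union> YZ_monomials m" for u s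
    using that by (intro ring_module.span_base) blast
  have XYZ: "X3 ^ i * Y3 ^ a * Z3 ^ b \<in> ?E" if deg: "i + a + b = m + 2" "a + b > 0" for i a b
  proof (cases a)
    case (Suc a')
    have "Y3 * (X3 ^ i * Y3 ^ a' * Z3 ^ b) \<in> ?E"
      using deg Suc by (intro prod) (auto simp: XYZ_monomials_def)
    then show ?thesis by (simp add: Suc mult_ac)
  next
    case 0
    then obtain b' where b: "b = Suc b'" using deg by (cases b) auto
    have "Z3 * (X3 ^ i * Y3 ^ a * Z3 ^ b') \<in> ?E"
      using deg b by (intro prod) (auto simp: XYZ_monomials_def)
    then show ?thesis by (simp add: b mult_ac)
  qed
  show ?thesis
  proof (intro subsetI, elim UnE)
    fix s :: "'a fps3" assume "s \<in> XYZ_monomials (m + 2)"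
    then obtain i a b where s: "s = X3 ^ i * Y3 ^ a * Z3 ^ b" and iab: "i + a + b = m + 2"
      by (auto simp: XYZ_monomials_def)
    show "s \<in> ?E"
    proof (cases "a + b > 0")
      case False
      then have s: "s = X3 ^ (m + 2 - N) * X3 ^ N" using s iab assms by (simp flip: power_add)
      have "X3 ^ (m + 2 - N) * fermat_poly N - X3 ^ (m + 2 - N) * Y3 ^ N * Z3 ^ 0
          - X3 ^ (m + 2 - N) * Y3 ^ 0 * Z3 ^ N \<in> ?E"
        using assms
        by (intro ring_module.span_diff XYZ ring_module.span_scale[OF ring_module.span_base]) auto
      then show ?thesis by (simp add: s algebra_simps)
    qed (use s iab XYZ in blast)
  next
    fix s :: "'a fps3" assume "s \<in> YZ_monomials (m + 1)"
    then obtain a b where s: "s = Y3 ^ a * Z3 ^ b" and ab: "a + b = m + 1"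
      by (auto simp: YZ_monomials_def)
    show "s \<in> ?E"
    proof (cases a)
      case (Suc a')
      have "Y3 * (Y3 ^ a' * Z3 ^ b) \<in> ?E"
        using ab Suc by (intro prod) (auto simp: YZ_monomials_def)
      then show ?thesis by (simp add: s Suc mult_ac)
    next
      case 0
      have "Y3 ^ a * Z3 ^ m \<in> YZ_monomials m"
        unfolding YZ_monomials_def using 0 by (intro CollectI exI[of _ a] exI[of _ m]) simp
      then have "Z3 * (Y3 ^ a * Z3 ^ m) \<in> ?E" by (intro prod) auto
      then show ?thesis using ab by (simp add: s 0 mult_ac)
    qed
  qed
qed

text \<open>Setting \<open>Y = Z = 0\<close> turns the ideal into \<open>(X^N)\<close>; the
  coefficient of \<open>X^(N - 1)\<close> then gives the contradiction.\<close>

lemma X3_power_notin_ideal_span: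
  assumes "N \<ge> 1"
  shows "X3 ^ (N - 1) \<notin> ideal_span (insert (fermat_poly N) {Y3, Z3 :: 'a::field fps3})"
proof
  assume "X3 ^ (N - 1) \<in> ideal_span (insert (fermat_poly N) {Y3, Z3 :: 'a fps3})"
  then obtain a b c :: "'a fps3" where "X3 ^ (N - 1) - a * fermat_poly N - b * Y3 - c * Z3 = 0"
    by (auto simp: ring_module.span_insert)
  then have "X3 ^ (N - 1) * 1 = X3 ^ N * a + Y3 ^ N * a + Z3 ^ N * a + Y3 ^ 1 * b + Z3 ^ 1 * c"
    by (simp add: algebra_simps)
  then have "(X3 ^ (N - 1) * 1 :: 'a fps3) $ 0 $ 0 $ (N - 1)
      = (X3 ^ N * a + Y3 ^ N * a + Z3 ^ N * a + Y3 ^ 1 * b + Z3 ^ 1 * c) $ 0 $ 0 $ (N - 1)" by simp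
  moreover have "(X3 ^ (N - 1) * 1 :: 'a fps3) $ 0 $ 0 $ (N - 1) = 1"
    unfolding X3_power_mult_nth by simp
  moreover have "(X3 ^ N * a) $ 0 $ 0 $ (N - 1) = 0" "(Y3 ^ N * a) $ 0 $ 0 = 0" "(Z3 ^ N * a) $ 0 = 0"
    "(Y3 ^ 1 * b) $ 0 $ 0 = 0" "(Z3 ^ 1 * c) $ 0 = 0"
    using assms unfolding fps3_power_mult_nth by simp_all
  ultimately show False by (simp only: fps_add_nth) simp
qed

section \<open>Transfer to the Fermat ring\<close>

text \<open>Ideals of the quotient are handled as images of spans, which turns sums, products and
  Frobenius powers into operations on generating sets.\<close>

locale surjective_ring_map = cring R for R (structure) +
  fixes \<pi> :: "'p::comm_ring_1 \<Rightarrow> 'a"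
  assumes map_add: "\<pi> (x + y) = \<pi> x \<oplus> \<pi> y"
    and map_mult: "\<pi> (x * y) = \<pi> x \<otimes> \<pi> y"
    and map_1: "\<pi> 1 = \<one>"
    and range_map: "range \<pi> = carrier R"
begin

lemma map_closed [simp]: "\<pi> x \<in> carrier R"
  using range_map by blast

lemma map_0: "\<pi> 0 = \<zero>"
  using map_add[of 0 0] by (metis add.r_cancel_one map_closed add_0)

lemma map_minus: "\<pi> (- x) = \<ominus> \<pi> x"
  using map_add[of "- x" x] by (simp add: map_0 minus_equality)

lemma map_power: "\<pi> (x ^ n) = \<pi> x [^] n"
  by (induction n) (auto simp: map_1 map_mult m_comm)

lemma ideal_image:
  assumes "ring_module.subspace E"
  shows "ideal (\<pi> ` E) R"
proof (rule idealI)
  note closed = ring_module.subspace_0[OF assms] ring_module.subspace_add[OF assms]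
    ring_module.subspace_neg[OF assms] ring_module.subspace_scale[OF assms]
  show "ring R" by (rule ring_axioms)
  show "subgroup (\<pi> ` E) (add_monoid R)"
  proof
    show "\<pi> ` E \<subseteq> carrier (add_monoid R)" by auto
    show "x \<otimes>\<^bsub>add_monoid R\<^esub> y \<in> \<pi> ` E" if "x \<in> \<pi> ` E" "y \<in> \<pi> ` E" for x y
      using that closed by (auto simp flip: map_add)
    show "\<one>\<^bsub>add_monoid R\<^esub> \<in> \<pi> ` E"
      using closed by (auto simp flip: map_0)
    show "inv\<^bsub>add_monoid R\<^esub> x \<in> \<pi> ` E" if "x \<in> \<pi> ` E" for x
      using that closed by (auto simp flip: map_minus a_inv_def)
  qed
  show *: "x \<otimes> a \<in> \<pi> ` E" if a: "a \<in> \<pi> ` E" and x: "x \<in> carrier R" for a x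
  proof -
    obtain c where "x = \<pi> c" using x range_map by blast
    then show ?thesis using a closed by (auto simp flip: map_mult)
  qed
  show "a \<otimes> x \<in> \<pi> ` E" if "a \<in> \<pi> ` E" "x \<in> carrier R" for a x
    using *[OF that] that by (metis imageE m_comm map_closed)
qed

lemma ideal_image_span: "ideal (\<pi> ` ideal_span S) R"
  by (intro ideal_image ring_module.subspace_span)

lemma genideal_image: "Idl (\<pi> ` S) = \<pi> ` ideal_span S"
proof
  show "Idl (\<pi> ` S) \<subseteq> \<pi> ` ideal_span S"
    by (intro genideal_minimal ideal_image_span image_mono ring_module.span_superset)
  interpret I: ideal "Idl (\<pi> ` S)" R by (rule genideal_ideal) auto
  have "\<pi> x \<in> Idl (\<pi> ` S)" if "x \<in> ideal_span S" for x
    using that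
  proof (induction rule: ring_module.span_induct_alt)
    case (step c x y)
    have "\<pi> ` S \<subseteq> Idl (\<pi> ` S)" by (intro genideal_self) auto
    then have "\<pi> x \<in> Idl (\<pi> ` S)" using step by blast
    then show ?case using step by (simp add: map_add map_mult I.I_l_closed)
  qed (simp add: map_0)
  then show "\<pi> ` ideal_span S \<subseteq> Idl (\<pi> ` S)" by blast
qed

lemma ideal_prod_image:
  "(\<pi> ` ideal_span S) \<cdot> (\<pi> ` ideal_span T) = \<pi> ` ideal_span {s * t | s t. s \<in> S \<and> t \<in> T}"
    (is "?P = \<pi> ` ?E")
proof
  show "?P \<subseteq> \<pi> ` ?E"
  proof
    fix x assume "x \<in> ?P"
    then show "x \<in> \<pi> ` ?E"
    proof (induction rule: ideal_prod.induct)
      case (prod i j)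
      then obtain a b where a: "a \<in> ideal_span S" and b: "b \<in> ideal_span T" and ij: "i = \<pi> a" "j = \<pi> b"
        by blast
      have "a * b \<in> ?E" using b
      proof (rule ideal_span_mult_mem)
        fix t assume t: "t \<in> T"
        have "t * a \<in> ?E" using a
        proof (rule ideal_span_mult_mem)
          fix s assume "s \<in> S"
          then have "s * t \<in> ?E" using t by (intro ring_module.span_base) blast
          then show "t * s \<in> ?E" by (simp add: mult.commute)
        qed
        then show "a * t \<in> ?E" by (simp add: mult.commute)
      qed
      then show ?case by (auto simp: ij simp flip: map_mult)
    next
      case (sum s1 s2)
      then show ?case by (auto simp flip: map_add intro: ring_module.span_add)
    qed
  qed
  have "ideal ?P R" by (intro ideal_prod_is_ideal ideal_image_span)
  moreover have "\<pi> ` {s * t | s t. s \<in> S \<and> t \<in> T} \<subseteq> ?P"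
    by (auto simp: map_mult intro!: ideal_prod.prod imageI ring_module.span_base)
  ultimately show "\<pi> ` ?E \<subseteq> ?P"
    unfolding genideal_image[symmetric] by (rule genideal_minimal)
qed

lemma set_add_image: "\<pi> ` ideal_span S <+> \<pi> ` ideal_span T = \<pi> ` ideal_span (S \<union> T)"
proof -
  have "\<pi> ` ideal_span S <+> \<pi> ` ideal_span T = {\<pi> (x + y) | x y. x \<in> ideal_span S \<and> y \<in> ideal_span T}"
    unfolding set_add_def' map_add by blast
  then show ?thesis unfolding ring_module.span_Un by blast
qed

lemma image_ideal_span_subset_iff:
  "\<pi> ` ideal_span S \<subseteq> \<pi> ` ideal_span T \<longleftrightarrow> \<pi> ` S \<subseteq> \<pi> ` ideal_span T"
proof
  assume "\<pi> ` S \<subseteq> \<pi> ` ideal_span T"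
  then show "\<pi> ` ideal_span S \<subseteq> \<pi> ` ideal_span T"
    unfolding genideal_image[symmetric, of S] by (intro genideal_minimal ideal_image_span)
qed (use ring_module.span_superset in blast)

end

text \<open>The definition takes powers of all elements of the ideal; by additivity of Frobenius the
  powers of generators suffice.\<close>

lemma frobenius_power_image:
  fixes \<pi> :: "'p::idom \<Rightarrow> 'a"
  assumes "surjective_ring_map R \<pi>" "CHAR('p) > 0"
  shows "frobenius_power R (\<pi> ` ideal_span S) (CHAR('p) ^ e) = \<pi> ` ideal_span ((\<lambda>s. s ^ (CHAR('p) ^ e)) ` S)"
proof -
  interpret surjective_ring_map R \<pi> by fact
  let ?F = "\<lambda>s :: 'p. s ^ (CHAR('p) ^ e)"
  have "(\<lambda>a. a [^]\<^bsub>R\<^esub> (CHAR('p) ^ e)) ` (\<pi> ` ideal_span S) = \<pi> ` (?F ` ideal_span S)"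
    by (simp add: image_image map_power)
  moreover have "ideal_span (?F ` ideal_span S) = ideal_span (?F ` S)"
  proof
    show "ideal_span (?F ` ideal_span S) \<subseteq> ideal_span (?F ` S)"
      using assms(2) by (intro ring_module.span_minimal ring_module.subspace_span)
        (auto intro: ideal_span_power_CHAR)
    show "ideal_span (?F ` S) \<subseteq> ideal_span (?F ` ideal_span S)"
      by (intro ring_module.span_mono image_mono ring_module.span_superset)
  qed
  ultimately show ?thesis by (simp add: frobenius_power_def genideal_image)
qed

text \<open>Reduces the condition on the multiplier in the tight closure to being nonzero.\<close>

lemma minimal_primes_domain:
  assumes "domain R"
  shows "minimal_primes R = {{\<zero>\<^bsub>R\<^esub>}}"
proof -
  interpret domain R by fact
  have zero: "{\<zero>\<^bsub>R\<^esub>} \<subseteq> Q" if "primeideal Q R" for Q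
    using that by (simp add: primeideal_def ideal_def additive_subgroup.zero_closed)
  show ?thesis
    using zero zeroprimeideal unfolding minimal_primes_def by blast
qed

lemma ideal_fermat_ideal: "ideal (fermat_ideal N) (ring_of_type_algebra :: 'a::field fps3 ring)"
proof -
  interpret cring "ring_of_type_algebra :: 'a fps3 ring" by (rule cring_from_type_algebra)
  show ?thesis unfolding fermat_ideal_def
    by (intro genideal_ideal) (simp add: ring_of_type_algebra_def)
qed

lemma fermat_ideal_eq: "fermat_ideal N = {f :: 'a::field fps3. fermat_poly N dvd f}"
proof -
  interpret cring "ring_of_type_algebra :: 'a fps3 ring" by (rule cring_from_type_algebra)
  have "fermat_ideal N = PIdl\<^bsub>ring_of_type_algebra\<^esub> (fermat_poly N :: 'a fps3)"
    unfolding fermat_ideal_def by (intro cgenideal_eq_genideal[symmetric]) (simp add: ring_of_type_algebra_def)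
  then show ?thesis
    by (auto simp: cgenideal_def ring_of_type_algebra_def dvd_def mult.commute)
qed

lemma surjective_ring_map_fermat_residue:
  "surjective_ring_map (fermat_ring N) (fermat_residue N :: 'a::field fps3 \<Rightarrow> _)"
proof -
  let ?P = "ring_of_type_algebra :: 'a fps3 ring"
  interpret P: cring ?P by (rule cring_from_type_algebra)
  interpret J: ideal "fermat_ideal N" ?P by (rule ideal_fermat_ideal)
  interpret R: cring "fermat_ring N :: 'a fps3 set ring"
    unfolding fermat_ring_def by (rule J.quotient_is_cring) (rule P.cring_axioms)
  have P: "carrier ?P = UNIV" "x \<oplus>\<^bsub>?P\<^esub> y = x + y" "x \<otimes>\<^bsub>?P\<^esub> y = x * y" "\<one>\<^bsub>?P\<^esub> = 1" for x y
    by (simp_all add: ring_of_type_algebra_def)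
  note hom = J.rcos_ring_hom
  show ?thesis
  proof
    show "fermat_residue N (x + y) = fermat_residue N x \<oplus>\<^bsub>fermat_ring N\<^esub> fermat_residue N y" for x y :: "'a fps3"
      using ring_hom_add[OF hom, of x y] by (simp add: fermat_residue_def fermat_ring_def P)
    show "fermat_residue N (x * y) = fermat_residue N x \<otimes>\<^bsub>fermat_ring N\<^esub> fermat_residue N y" for x y :: "'a fps3"
      using ring_hom_mult[OF hom, of x y] by (simp add: fermat_residue_def fermat_ring_def P)
    show "fermat_residue N (1 :: 'a fps3) = \<one>\<^bsub>fermat_ring N\<^esub>"
      using ring_hom_one[OF hom] by (simp add: fermat_residue_def fermat_ring_def P)
    show "range (fermat_residue N :: 'a fps3 \<Rightarrow> _) = carrier (fermat_ring N)"
      by (auto simp: fermat_residue_def fermat_ring_def FactRing_def A_RCOSETS_def' P)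
  qed
qed

lemma fermat_residue_eq_iff:
  fixes f g :: "'a::field fps3"
  shows "fermat_residue N f = fermat_residue N g \<longleftrightarrow> fermat_poly N dvd f - g"
proof -
  let ?P = "ring_of_type_algebra :: 'a fps3 ring"
  have coset: "fermat_residue N f = {x. fermat_poly N dvd x - f}" for f :: "'a fps3"
  proof -
    have "fermat_residue N f = {h + f | h. fermat_poly N dvd h}"
      by (auto simp: fermat_residue_def a_r_coset_def' fermat_ideal_eq ring_of_type_algebra_def)
    also have "\<dots> = {x. fermat_poly N dvd x - f}"
    proof (intro equalityI subsetI)
      fix x assume "x \<in> {x. fermat_poly N dvd x - f}"
      then show "x \<in> {h + f | h. fermat_poly N dvd h}" by (intro CollectI exI[of _ "x - f"]) simp
    qed auto
    finally show ?thesis .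
  qed
  show ?thesis
  proof
    assume eq: "fermat_residue N f = fermat_residue N g"
    have "f \<in> fermat_residue N f" by (simp add: coset)
    then show "fermat_poly N dvd f - g" unfolding eq unfolding coset by simp
  next
    assume *: "fermat_poly N dvd f - g"
    have "fermat_poly N dvd x - f \<longleftrightarrow> fermat_poly N dvd x - g" for x
    proof -
      have "x - g = (f - g) + (x - f)" by simp
      then show ?thesis using dvd_add_right_iff[OF *, of "x - f"] by (simp only:)
    qed
    then show "fermat_residue N f = fermat_residue N g" unfolding coset by simp
  qed
qed

lemma fermat_residue_in_image_span_iff:
  "fermat_residue N f \<in> fermat_residue N ` ideal_span S
    \<longleftrightarrow> f \<in> ideal_span (insert (fermat_poly N) S)"
  unfolding in_ideal_span_insert_iff by (auto simp: fermat_residue_eq_iff)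

text \<open>The branch embeds the quotient into a power series ring over a domain.\<close>

lemma domain_fermat_ring:
  assumes "\<not> CHAR('a::field) dvd N"
  shows "domain (fermat_ring N :: 'a fps3 set ring)"
proof -
  interpret surjective_ring_map "fermat_ring N" "fermat_residue N :: 'a fps3 \<Rightarrow> _"
    by (rule surjective_ring_map_fermat_residue)
  obtain t where "fermat_branch N (t :: 'a alg_closure fps)"
    using fermat_branch_exists_if_CHAR_not_dvd[OF assms] by blast
  then interpret fermat_branch N t .
  have zero: "fermat_residue N f = \<zero>\<^bsub>fermat_ring N\<^esub> \<longleftrightarrow> fermat_poly N dvd f" for f :: "'a fps3"
    using fermat_residue_eq_iff[of N f 0] by (simp add: map_0)
  show ?thesis
  proof
    show "\<one>\<^bsub>fermat_ring N\<^esub> \<noteq> (\<zero>\<^bsub>fermat_ring N\<^esub> :: 'a fps3 set)"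
      using Y3_power_not_dvd[of 0] unfolding map_1[symmetric] zero by simp
    fix a b :: "'a fps3 set"
    assume prod: "a \<otimes>\<^bsub>fermat_ring N\<^esub> b = \<zero>\<^bsub>fermat_ring N\<^esub>" and "a \<in> carrier (fermat_ring N)" "b \<in> carrier (fermat_ring N)"
    then obtain f g where ab: "a = fermat_residue N f" "b = fermat_residue N g"
      unfolding range_map[symmetric] by blast
    from prod have "fermat_residue N (f * g) = \<zero>\<^bsub>fermat_ring N\<^esub>" by (simp only: ab map_mult)
    then show "a = \<zero>\<^bsub>fermat_ring N\<^esub> \<or> b = \<zero>\<^bsub>fermat_ring N\<^esub>"
      by (simp only: ab zero fermat_poly_dvd_mult_iff)
  qed
qed

section \<open>Ideal powers and tight closures in the Fermat ring\<close>

lemma ideal_power_fermat_YZ: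
  "ideal_power (fermat_ring N) (fermat_residue N ` ideal_span {Y3, Z3}) k
    = fermat_residue N ` ideal_span (YZ_monomials k :: 'a::field fps3 set)"
proof (induction k)
  interpret surjective_ring_map "fermat_ring N" "fermat_residue N :: 'a fps3 \<Rightarrow> _"
    by (rule surjective_ring_map_fermat_residue)
  {
    case 0
    have "ideal_span (YZ_monomials 0 :: 'a fps3 set) = UNIV"
      using in_ideal_span_YZ_monomials[of 0] by auto
    then show ?case by (simp add: nat_pow_def ideals_set_def range_map)
  next
    case (Suc k)
    have "{s * u | s u. s \<in> YZ_monomials k \<and> u \<in> {Y3, Z3}} = (YZ_monomials (Suc k) :: 'a fps3 set)"
    proof (intro equalityI subsetI)
      fix x :: "'a fps3" assume "x \<in> {s * u | s u. s \<in> YZ_monomials k \<and> u \<in> {Y3, Z3}}"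
      then obtain s u where "x = s * u" "s \<in> YZ_monomials k" "u = Y3 \<or> u = Z3" by blast
      then show "x \<in> YZ_monomials (Suc k)" using mult_YZ_monomials[of s k] by (metis mult.commute)
    next
      fix x :: "'a fps3" assume "x \<in> YZ_monomials (Suc k)"
      then obtain a b where x: "x = Y3 ^ a * Z3 ^ b" and ab: "a + b = Suc k" by (auto simp: YZ_monomials_def)
      have mem: "Y3 ^ a * Z3 ^ b \<in> YZ_monomials k" if "a + b = k" for a b
        using that by (auto simp: YZ_monomials_def)
      have "\<exists>s\<in>YZ_monomials k. x = s * Y3 \<or> x = s * Z3"
      proof (cases a)
        case 0
        then show ?thesis using x ab by (intro bexI[OF _ mem[of a k]]) (auto simp: mult_ac)
      next
        case (Suc a')
        then show ?thesis using x ab by (intro bexI[OF _ mem[of a' b]]) (auto simp: mult_ac)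
      qed
      then show "x \<in> {s * u | s u. s \<in> YZ_monomials k \<and> u \<in> {Y3, Z3}}" by blast
    qed
    moreover have "ideal_power (fermat_ring N) (fermat_residue N ` ideal_span {Y3, Z3}) (Suc k)
      = fermat_residue N ` ideal_span (YZ_monomials k) \<cdot>\<^bsub>fermat_ring N\<^esub> fermat_residue N ` ideal_span {Y3, Z3 :: 'a fps3}"
      using Suc by (simp add: nat_pow_def ideals_set_def)
    ultimately show ?case by (simp add: ideal_prod_image)
  }
qed

lemma ideal_power_fermat_XYZ:
  "ideal_power (fermat_ring N) (fermat_residue N ` ideal_span {X3, Y3, Z3}) k
    = fermat_residue N ` ideal_span (XYZ_monomials k :: 'a::field fps3 set)"
proof (induction k)
  interpret surjective_ring_map "fermat_ring N" "fermat_residue N :: 'a fps3 \<Rightarrow> _"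
    by (rule surjective_ring_map_fermat_residue)
  {
    case 0
    have "ideal_span (XYZ_monomials 0 :: 'a fps3 set) = UNIV"
      using in_ideal_span_XYZ_monomials[of 0] by auto
    then show ?case by (simp add: nat_pow_def ideals_set_def range_map)
  next
    case (Suc k)
    have "{s * u | s u. s \<in> XYZ_monomials k \<and> u \<in> {X3, Y3, Z3}} = (XYZ_monomials (Suc k) :: 'a fps3 set)"
    proof (intro equalityI subsetI)
      fix x :: "'a fps3" assume "x \<in> {s * u | s u. s \<in> XYZ_monomials k \<and> u \<in> {X3, Y3, Z3}}"
      then obtain s u where "x = s * u" "s \<in> XYZ_monomials k" "u = X3 \<or> u = Y3 \<or> u = Z3" by blast
      then show "x \<in> XYZ_monomials (Suc k)" using mult_XYZ_monomials[of s k] by (metis mult.commute)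
    next
      fix x :: "'a fps3" assume "x \<in> XYZ_monomials (Suc k)"
      then obtain i a b where x: "x = X3 ^ i * Y3 ^ a * Z3 ^ b" and iab: "i + a + b = Suc k"
        by (auto simp: XYZ_monomials_def)
      have mem: "X3 ^ i * Y3 ^ a * Z3 ^ b \<in> XYZ_monomials k" if "i + a + b = k" for i a b
        using that by (auto simp: XYZ_monomials_def)
      consider i' where "i = Suc i'" | a' where "a = Suc a'" | b' where "b = Suc b'"
        using iab by (cases i; cases a; cases b) auto
      then have "\<exists>s\<in>XYZ_monomials k. x = s * X3 \<or> x = s * Y3 \<or> x = s * Z3"
      proof cases
        case 1
        then show ?thesis using x iab by (intro bexI[OF _ mem[of i' a b]]) (auto simp: mult_ac)
      next
        case 2
        then show ?thesis using x iab by (intro bexI[OF _ mem[of i a' b]]) (auto simp: mult_ac)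
      next
        case 3
        then show ?thesis using x iab by (intro bexI[OF _ mem[of i a b']]) (auto simp: mult_ac)
      qed
      then show "x \<in> {s * u | s u. s \<in> XYZ_monomials k \<and> u \<in> {X3, Y3, Z3}}" by blast
    qed
    moreover have "ideal_power (fermat_ring N) (fermat_residue N ` ideal_span {X3, Y3, Z3}) (Suc k)
      = fermat_residue N ` ideal_span (XYZ_monomials k) \<cdot>\<^bsub>fermat_ring N\<^esub> fermat_residue N ` ideal_span {X3, Y3, Z3 :: 'a fps3}"
      using Suc by (simp add: nat_pow_def ideals_set_def)
    ultimately show ?case by (simp add: ideal_prod_image)
  }
qed

lemma tight_closure_fermat:
  assumes CHAR: "CHAR('a::field) > 0" "\<not> CHAR('a) dvd N"
  shows "tight_closure CHAR('a) (fermat_ring N) (fermat_residue N ` ideal_span (YZ_monomials k :: 'a fps3 set))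
    = fermat_residue N ` ideal_span (XYZ_monomials (k + 1) \<union> YZ_monomials k)"
proof -
  let ?R = "fermat_ring N :: 'a fps3 set ring" and ?\<pi> = "fermat_residue N :: 'a fps3 \<Rightarrow> _"
  let ?F = "\<lambda>e. ideal_span ((\<lambda>s. s ^ (CHAR('a) ^ e)) ` (YZ_monomials k :: 'a fps3 set))"
  interpret surjective_ring_map ?R ?\<pi> by (rule surjective_ring_map_fermat_residue)
  obtain t where "fermat_branch N (t :: 'a alg_closure fps)"
    using fermat_branch_exists_if_CHAR_not_dvd[OF CHAR(2)] by blast
  then interpret fermat_branch N t .
  have frob: "frobenius_power ?R (?\<pi> ` ideal_span (YZ_monomials k)) (CHAR('a) ^ e) = ?\<pi> ` ?F e" for e
    using frobenius_power_image[OF surjective_ring_map_axioms, of "YZ_monomials k" e] CHAR by simp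
  have c: "?\<pi> c \<in> carrier ?R - \<Union>(minimal_primes ?R) \<longleftrightarrow> \<not> fermat_poly N dvd c" for c
    using fermat_residue_eq_iff[of N c 0] minimal_primes_domain[OF domain_fermat_ring[OF CHAR(2)]]
    by (simp add: map_0)
  \<comment> \<open>Tight closure membership restated in the power series ring, as a congruence
    modulo the Fermat polynomial.\<close>
  have tight: "?\<pi> f \<in> tight_closure CHAR('a) ?R (?\<pi> ` ideal_span (YZ_monomials k)) \<longleftrightarrow>
    (\<exists>c. \<not> fermat_poly N dvd c \<and> (\<exists>e0. \<forall>e\<ge>e0. \<exists>g\<in>?F e. fermat_poly N dvd c * f ^ (CHAR('a) ^ e) - g))" for f
  proof -
    have "?\<pi> f \<in> tight_closure CHAR('a) ?R (?\<pi> ` ideal_span (YZ_monomials k)) \<longleftrightarrow>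
      (\<exists>c\<in>range ?\<pi> - \<Union>(minimal_primes ?R). \<exists>e0. \<forall>e\<ge>e0. c \<otimes>\<^bsub>?R\<^esub> ?\<pi> f [^]\<^bsub>?R\<^esub> (CHAR('a) ^ e) \<in> ?\<pi> ` ?F e)"
      by (simp add: tight_closure_def frob range_map)
    also have "\<dots> \<longleftrightarrow> (\<exists>c. ?\<pi> c \<in> carrier ?R - \<Union>(minimal_primes ?R) \<and>
        (\<exists>e0. \<forall>e\<ge>e0. ?\<pi> (c * f ^ (CHAR('a) ^ e)) \<in> ?\<pi> ` ?F e))"
      by (auto simp: map_mult map_power)
    finally show ?thesis
      by (simp only: c fermat_residue_in_image_span_iff in_ideal_span_insert_iff)
  qed
  show ?thesis
  proof (intro equalityI subsetI)
    fix u assume u: "u \<in> tight_closure CHAR('a) ?R (?\<pi> ` ideal_span (YZ_monomials k))"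
    then have "u \<in> carrier ?R" by (simp add: tight_closure_def)
    then obtain f where f: "u = ?\<pi> f" unfolding range_map[symmetric] by blast
    from u[unfolded f tight] obtain c e0 where "\<not> fermat_poly N dvd c"
      "\<And>e. e \<ge> e0 \<Longrightarrow> \<exists>g\<in>?F e. fermat_poly N dvd c * f ^ (CHAR('a) ^ e) - g" by blast
    from fermat_tight_closure_upper_bound[OF CHAR this]
    show "u \<in> ?\<pi> ` ideal_span (XYZ_monomials (k + 1) \<union> YZ_monomials k)"
      unfolding f fermat_residue_in_image_span_iff in_ideal_span_insert_iff .
  next
    fix u assume "u \<in> ?\<pi> ` ideal_span (XYZ_monomials (k + 1) \<union> YZ_monomials k)"
    then obtain f where f: "u = ?\<pi> f" "f \<in> ideal_span (XYZ_monomials (k + 1) \<union> YZ_monomials k)" by blast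
    \<comment> \<open>The multiplier \<open>Y^N\<close> serves all exponents \<open>e\<close> at
      once.\<close>
    have "\<exists>g\<in>?F e. fermat_poly N dvd Y3 ^ N * f ^ (CHAR('a) ^ e) - g" for e
      using fermat_tight_closure_lower_bound[OF CHAR(1) refl N_pos f(2), of e]
      unfolding in_ideal_span_insert_iff .
    then show "u \<in> tight_closure CHAR('a) ?R (?\<pi> ` ideal_span (YZ_monomials k))"
      unfolding f(1) tight using Y3_power_not_dvd by blast
  qed
qed

theorem proposition5p9:
  fixes N p :: nat
    and R :: "'a::field fps3 set ring"
    and x y z :: "'a fps3 set"
    and I \<mm> :: "'a fps3 set set"
  assumes "N \<ge> 3"
    and "infinite (UNIV :: 'a set)"
    and "CHAR('a) = p" and "p > 0" and "\<not> p dvd N"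
    and "R = fermat_ring N"
    and "x = fermat_residue N X3" and "y = fermat_residue N Y3" and "z = fermat_residue N Z3"
    and "I = Idl\<^bsub>R\<^esub> {y, z}" and "\<mm> = Idl\<^bsub>R\<^esub> {x, y, z}"
  shows "(\<forall>k\<ge>1. tight_closure p R (ideal_power R I k)
                  = ideal_power R \<mm> (k + 1) <+>\<^bsub>R\<^esub> ideal_power R I k)
       \<and> tight_reduction_number p R I = enat (N - 2)"
proof -
  let ?\<pi> = "fermat_residue N :: 'a fps3 \<Rightarrow> _"
  interpret surjective_ring_map R ?\<pi>
    unfolding \<open>R = fermat_ring N\<close> by (rule surjective_ring_map_fermat_residue)
  have I: "I = ?\<pi> ` ideal_span {Y3, Z3}" and \<mm>: "\<mm> = ?\<pi> ` ideal_span {X3, Y3, Z3}"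
    using assms genideal_image[of "{Y3, Z3}"] genideal_image[of "{X3, Y3, Z3}"] by simp_all
  have I_pow: "ideal_power R I k = ?\<pi> ` ideal_span (YZ_monomials k)" for k
    unfolding I \<open>R = fermat_ring N\<close> by (rule ideal_power_fermat_YZ)
  have \<mm>_pow: "ideal_power R \<mm> k = ?\<pi> ` ideal_span (XYZ_monomials k)" for k
    unfolding \<mm> \<open>R = fermat_ring N\<close> by (rule ideal_power_fermat_XYZ)
  \<comment> \<open>This includes \<open>k = 0\<close>, where the filtration starts; for
    \<open>N = 3\<close> the failing index \<open>N - 3\<close> is 0.\<close>
  have tc: "tight_closure p R (ideal_power R I k) = ?\<pi> ` ideal_span (XYZ_monomials (k + 1) \<union> YZ_monomials k)" for k
    unfolding I_pow unfolding \<open>R = fermat_ring N\<close> using tight_closure_fermat assms by blast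
  have part1: "tight_closure p R (ideal_power R I k) = ideal_power R \<mm> (k + 1) <+>\<^bsub>R\<^esub> ideal_power R I k" for k
    unfolding tc unfolding I_pow \<mm>_pow set_add_image ..
  define M :: "nat \<Rightarrow> 'a fps3 set" where
    "M m = {u * s | u s. u \<in> {Y3, Z3} \<and> s \<in> XYZ_monomials (m + 1) \<union> YZ_monomials m}" for m
  have prod: "I \<cdot>\<^bsub>R\<^esub> tight_closure p R (ideal_power R I m) = ?\<pi> ` ideal_span (M m)" for m
    unfolding tc unfolding I M_def by (rule ideal_prod_image)
  have reduce: "I \<cdot>\<^bsub>R\<^esub> tight_closure p R (ideal_power R I m) = tight_closure p R (ideal_power R I (m + 1))"
    if "m \<ge> N - 2" for m
  proof
    have "M m \<subseteq> XYZ_monomials (m + 2) \<union> YZ_monomials (m + 1)"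
      unfolding M_def by (auto simp: mult_XYZ_monomials mult_YZ_monomials)
    then show "I \<cdot>\<^bsub>R\<^esub> tight_closure p R (ideal_power R I m) \<subseteq> tight_closure p R (ideal_power R I (m + 1))"
      unfolding prod unfolding tc by (intro image_mono ring_module.span_mono) simp
    have "XYZ_monomials (m + 2) \<union> YZ_monomials (m + 1) \<subseteq> ideal_span (insert (fermat_poly N) (M m))"
      unfolding M_def using that assms(1) by (intro XYZ_monomials_subset_reduction) auto
    then have "?\<pi> ` (XYZ_monomials (m + 2) \<union> YZ_monomials (m + 1)) \<subseteq> ?\<pi> ` ideal_span (M m)"
      using fermat_residue_in_image_span_iff[of N _ "M m"] by blast
    then show "tight_closure p R (ideal_power R I (m + 1)) \<subseteq> I \<cdot>\<^bsub>R\<^esub> tight_closure p R (ideal_power R I m)"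
      unfolding prod unfolding tc image_ideal_span_subset_iff by simp
  qed
  \<comment> \<open>The element \<open>x^(N - 1)\<close> lies in \<open>\<mm>^(N - 1)\<close>, hence
    in the tight closure of \<open>I^(N - 2)\<close>. It is not in \<open>I\<close>, which contains
    the product on the left.\<close>
  have not_reduce: "I \<cdot>\<^bsub>R\<^esub> tight_closure p R (ideal_power R I (N - 3)) \<noteq> tight_closure p R (ideal_power R I (N - 3 + 1))"
  proof
    assume eq: "I \<cdot>\<^bsub>R\<^esub> tight_closure p R (ideal_power R I (N - 3)) = tight_closure p R (ideal_power R I (N - 3 + 1))"
    have "X3 ^ (N - 1) * Y3 ^ 0 * Z3 ^ 0 \<in> (XYZ_monomials (N - 3 + 1 + 1) :: 'a fps3 set)"
      unfolding XYZ_monomials_def using assms(1) by fastforce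
    then have "X3 ^ (N - 1) \<in> ideal_span (XYZ_monomials (N - 3 + 1 + 1) \<union> YZ_monomials (N - 3 + 1) :: 'a fps3 set)"
      by (intro ring_module.span_base) simp
    then have "?\<pi> (X3 ^ (N - 1)) \<in> tight_closure p R (ideal_power R I (N - 3 + 1))"
      unfolding tc by (rule imageI)
    then have "?\<pi> (X3 ^ (N - 1)) \<in> I \<cdot>\<^bsub>R\<^esub> tight_closure p R (ideal_power R I (N - 3))"
      unfolding eq .
    moreover have "ideal (tight_closure p R (ideal_power R I (N - 3))) R" "ideal I R"
      unfolding tc unfolding I by (rule ideal_image_span)+
    then have "I \<cdot>\<^bsub>R\<^esub> tight_closure p R (ideal_power R I (N - 3)) \<subseteq> I"
      using ideal_prod_inter by blast
    ultimately show False
      using X3_power_notin_ideal_span[of N, where 'a = 'a] assms(1)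
        fermat_residue_in_image_span_iff[of N "X3 ^ (N - 1)" "{Y3, Z3}"] by (auto simp: I)
  qed
  let ?red = "\<lambda>n. \<forall>m\<ge>n. I \<cdot>\<^bsub>R\<^esub> tight_closure p R (ideal_power R I m) = tight_closure p R (ideal_power R I (m + 1))"
  have "?red n \<longleftrightarrow> N - 2 \<le> n" for n
  proof
    assume "?red n"
    \<comment> \<open>Equality is demanded for all \<open>m \<ge> n\<close>, so the failure at
      \<open>N - 3\<close> excludes every smaller \<open>n\<close> too.\<close>
    then have "\<not> n \<le> N - 3" using not_reduce by blast
    then show "N - 2 \<le> n" using assms(1) by simp
  qed (auto intro!: reduce[simplified])
  then have "{enat n | n. ?red n} = {enat n | n. N - 2 \<le> n}" by blast
  then have "tight_reduction_number p R I = Inf {enat n | n. N - 2 \<le> n}"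
    unfolding tight_reduction_number_def reduction_number_def by simp
  also have "\<dots> = enat (N - 2)"
    by (intro antisym Inf_lower Inf_greatest) auto
  finally show ?thesis using part1 by blast
qed

end
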